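(* Let $I\subset R=\mathbb{K}[\mathbb{P}^2]$ be the ideal associated to a quasi star configuration of points $Z_d=T_d+S_2(2,d)$ in $\mathbb{P}^2$. Then the minimal free resolution of $I$ is of the form $$0\rightarrow R^d(-d-1)\rightarrow R^{d+1}(-d)\rightarrow I\rightarrow 0.$$ In particular, $\alpha(I)=\mathrm{reg}(I)=d$.
   Context: $\mathbb{K}$ is an algebraically closed field and $R=\mathbb{K}[\mathbb{P}^2]=\mathbb{K}[x_0,x_1,x_2]$ is the coordinate ring of the projective plane $\mathbb{P}^2$ over $\mathbb{K}$. Quasi star configuration: let $d\ge 3$ and let $L_1,\dots,L_d$ be general lines in $\mathbb{P}^2$ (pairwise distinct, no three passing through a common point). The star configuration $S_2(2,d)$ is the set of the $\binom{d}{2}$ points of pairwise intersection of these lines. Let $T_d=\{q_1,\dots,q_d\}$ be a set of $d$ distinct points of $\mathbb{P}^2$ with $T_d\cap S_2(2,d)=\varnothing$, with $q_i\in L_i$ for each $i=1,\dots,d$, and such that the points of $T_d$ are not collinear. Then $Z_d=T_d+S_2(2,d)$ (the union of these two sets of reduced points) is called a quasi star configuration. Its associated ideal is the radical homogeneous ideal generated by all forms vanishing at every point of $Z_d$. $\alpha(I)$, the initial degree, is the least degree of a nonzero polynomial in $I$. $\mathrm{reg}(I)$ is the Castelnuovo–Mumford regularity: if $0\to F_r\to\dots\to F_0\to I\to 0$ is a minimal graded free resolution of $I$ over $R$ and $f_j$ is the maximum degree of the generators of $F_j$, then $\mathrm{reg}(I)=\max\{f_j-j\mid j\ge 0\}$.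 $R^n(-k)$ denotes the graded free module of rank $n$ with all generators in degree $k$. *)

theory Defs
  imports
    "HOL-Library.Poly_Mapping"
    "HOL-Library.Numeral_Type"
    "HOL-Computational_Algebra.Polynomial"
    "Jordan_Normal_Form.Matrix_Kernel"
begin

text \<open>
  The variables are indexed by the three-element type \<open>3\<close>, whose elements are \<open>0\<close>, \<open>1\<close>, \<open>2\<close>.
  An element of \<open>'k coord_ring\<close> maps each exponent vector to its coefficient; the ring structure
  is the convolution product of \<^theory>\<open>HOL-Library.Poly_Mapping\<close>.
\<close>

type_synonym 'k coord_ring = "(3 \<Rightarrow>\<^sub>0 nat) \<Rightarrow>\<^sub>0 'k"

definition monom_degree :: "(3 \<Rightarrow>\<^sub>0 nat) \<Rightarrow> nat" where
  "monom_degree m = (\<Sum>i\<in>UNIV. poly_mapping.lookup m i)"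

definition poly_eval :: "'k::field coord_ring \<Rightarrow> (3 \<Rightarrow> 'k) \<Rightarrow> 'k" where
  "poly_eval f v = (\<Sum>m\<in>Poly_Mapping.keys f. poly_mapping.lookup f m * (\<Prod>i\<in>UNIV. v i ^ poly_mapping.lookup m i))"

definition variable :: "3 \<Rightarrow> 'k::field coord_ring" where
  "variable i = Poly_Mapping.single (Poly_Mapping.single i 1) 1"

text \<open>
  Degrees are integers, because the entries of the matrices below have degrees that are
  differences of shifts. Zero is homogeneous of every degree, and it is the only
  homogeneous element of a given negative degree.
\<close>

definition homogeneous :: "int \<Rightarrow> 'k::field coord_ring \<Rightarrow> bool" where
  "homogeneous n f \<longleftrightarrow> (\<forall>m\<in>Poly_Mapping.keys f. int (monom_degree m) = n)"

text \<open>Used only for \<open>f \<noteq> 0\<close>.\<close>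

definition total_degree :: "'k::field coord_ring \<Rightarrow> nat" where
  "total_degree f = Max (monom_degree ` Poly_Mapping.keys f)"

text \<open>The ring as a module over itself: spans are ideals.\<close>

definition ideal_generated :: "'k::field coord_ring set \<Rightarrow> 'k coord_ring set" where
  "ideal_generated S = Modules.module.span (*) S"

definition irrelevant_ideal :: "'k::field coord_ring set" where
  "irrelevant_ideal = ideal_generated (range variable)"


section \<open>Quasi star configurations\<close>

text \<open>A point of the projective plane is the set of all its homogeneous coordinate vectors.\<close>

definition proj_rel :: "((3 \<Rightarrow> 'k::field) \<times> (3 \<Rightarrow> 'k)) set" where
  "proj_rel = {(u, v). u \<noteq> (\<lambda>_. 0) \<and> v \<noteq> (\<lambda>_. 0) \<and> (\<exists>c. c \<noteq> 0 \<and> v = (\<lambda>i. c * u i))}"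

definition proj_plane :: "(3 \<Rightarrow> 'k::field) set set" where
  "proj_plane = {v. v \<noteq> (\<lambda>_. 0)} // proj_rel"

definition proj_line :: "(3 \<Rightarrow> 'k::field) set set \<Rightarrow> bool" where
  "proj_line L \<longleftrightarrow>
     (\<exists>a. a \<noteq> (\<lambda>_. 0) \<and> L = {p \<in> proj_plane. \<forall>v\<in>p. (\<Sum>i\<in>UNIV. a i * v i) = 0})"

definition general_lines :: "nat \<Rightarrow> (nat \<Rightarrow> (3 \<Rightarrow> 'k::field) set set) \<Rightarrow> bool" where
  "general_lines d L \<longleftrightarrow>
     (\<forall>i\<in>{1..d}. proj_line (L i)) \<and> inj_on L {1..d} \<and>
     (\<forall>i\<in>{1..d}. \<forall>j\<in>{1..d}. \<forall>k\<in>{1..d}.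
        i \<noteq> j \<and> j \<noteq> k \<and> i \<noteq> k \<longrightarrow> L i \<inter> L j \<inter> L k = {})"

definition star_configuration ::
    "nat \<Rightarrow> (nat \<Rightarrow> (3 \<Rightarrow> 'k::field) set set) \<Rightarrow> (3 \<Rightarrow> 'k) set set" where
  "star_configuration d L = (\<Union>i\<in>{1..d}. \<Union>j\<in>{1..d} - {i}. L i \<inter> L j)"

definition collinear_points :: "(3 \<Rightarrow> 'k::field) set set \<Rightarrow> bool" where
  "collinear_points T \<longleftrightarrow> (\<exists>L. proj_line L \<and> T \<subseteq> L)"

definition quasi_star_configuration :: "nat \<Rightarrow> (3 \<Rightarrow> 'k::field) set set \<Rightarrow> bool" where
  "quasi_star_configuration d Z \<longleftrightarrow> d \<ge> 3 \<and>
     (\<exists>L q. general_lines d L \<and>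
        inj_on q {1..d} \<and>
        (\<forall>i\<in>{1..d}. q i \<in> L i) \<and>
        q ` {1..d} \<inter> star_configuration d L = {} \<and>
        \<not> collinear_points (q ` {1..d}) \<and>
        Z = q ` {1..d} \<union> star_configuration d L)"

definition ideal_of_points :: "(3 \<Rightarrow> 'k::field) set set \<Rightarrow> 'k coord_ring set" where
  "ideal_of_points Z =
     ideal_generated {f. (\<exists>n. homogeneous n f) \<and> (\<forall>p\<in>Z. \<forall>v\<in>p. poly_eval f v = 0)}"


section \<open>Minimal graded free resolutions\<close>

text \<open>
  A list \<open>a\<close> of integers stands for the graded free module with one generator of degree
  \<open>a ! i\<close> for each \<open>i\<close>, that is, the direct sum of the \<open>R(- a ! i)\<close>. Its elements are the
  vectors of dimension \<open>length a\<close>. A degree-preserving homomorphism from the module of \<open>b\<close> to the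
  module of \<open>a\<close> is a matrix whose \<open>(i, k)\<close> entry is homogeneous of degree \<open>b ! k - a ! i\<close>.
\<close>

definition graded_hom :: "int list \<Rightarrow> int list \<Rightarrow> 'k::field coord_ring mat \<Rightarrow> bool" where
  "graded_hom b a A \<longleftrightarrow> A \<in> carrier_mat (length a) (length b) \<and>
     (\<forall>i<length a. \<forall>k<length b. homogeneous (b ! k - a ! i) (A $$ (i, k)))"

definition mat_image :: "'a::comm_ring_1 mat \<Rightarrow> 'a vec set" where
  "mat_image A = {A *\<^sub>v v | v. v \<in> carrier_vec (dim_col A)}"

text \<open>
  \<open>D j\<close> lists the degrees of the generators of \<open>F\<^sub>j\<close>, with \<open>D j = []\<close> for \<open>F\<^sub>j = 0\<close>. The matrix
  \<open>M 0\<close> is the augmentation from \<open>F\<^sub>0\<close> onto \<open>I\<close>, read as a map to \<open>R = R(0)\<close>, and \<open>M (Suc j)\<close> is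
  the differential from \<open>F\<^bsub>j+1\<^esub>\<close> to \<open>F\<^sub>j\<close>.
\<close>

definition graded_free_resolution ::
    "'k::field coord_ring set \<Rightarrow> (nat \<Rightarrow> int list) \<Rightarrow> (nat \<Rightarrow> 'k coord_ring mat) \<Rightarrow> bool" where
  "graded_free_resolution I D M \<longleftrightarrow>
     (\<exists>r. \<forall>j>r. D j = []) \<and>
     graded_hom (D 0) [0] (M 0) \<and>
     (\<forall>j. graded_hom (D (Suc j)) (D j) (M (Suc j))) \<and>
     (\<lambda>v. v $ 0) ` mat_image (M 0) = I \<and>
     (\<forall>j. mat_image (M (Suc j)) = mat_kernel (M j))"

text \<open>Minimality: the differential maps \<open>F\<^bsub>j+1\<^esub>\<close> into \<open>(x\<^sub>0, x\<^sub>1, x\<^sub>2) F\<^sub>j\<close>.\<close>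

definition minimal_free_resolution ::
    "'k::field coord_ring set \<Rightarrow> (nat \<Rightarrow> int list) \<Rightarrow> (nat \<Rightarrow> 'k coord_ring mat) \<Rightarrow> bool" where
  "minimal_free_resolution I D M \<longleftrightarrow>
     graded_free_resolution I D M \<and> (\<forall>j. elements_mat (M (Suc j)) \<subseteq> irrelevant_ideal)"

definition initial_degree :: "'k::field coord_ring set \<Rightarrow> nat" where
  "initial_degree I = (LEAST n. \<exists>f\<in>I. f \<noteq> 0 \<and> total_degree f = n)"

text \<open>
  All minimal graded free resolutions of \<open>I\<close> have the same generator degrees, so the description
  determines at most one number. Zero modules do not contribute to the maximum.
\<close>

definition regularity :: "'k::field coord_ring set \<Rightarrow> int" where
  "regularity I = (THE \<rho>. \<exists>D M. minimal_free_resolution I D M \<and>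
     \<rho> = Max {Max (set (D j)) - int j | j. D j \<noteq> []})"

end

theory Submission imports Defs
begin

text \<open>
  Write \<open>\<ell>\<^sub>i\<close> for a linear form defining the line \<open>L\<^sub>i\<close>, and choose a second linear form \<open>m\<^sub>i\<close> such
  that \<open>q\<^sub>i\<close> is the only common zero of \<open>\<ell>\<^sub>i\<close> and \<open>m\<^sub>i\<close>. The form \<open>F = \<ell>\<^sub>1 \<cdots> \<ell>\<^sub>d\<close> vanishes on the whole
  configuration, and so does \<open>g\<^sub>i = m\<^sub>i F / \<ell>\<^sub>i\<close>: a star point lies on two of the lines, so one of the
  remaining factors vanishes there, and \<open>q\<^sub>j\<close> is a zero of \<open>\<ell>\<^sub>j\<close> if \<open>j \<noteq> i\<close> and of \<open>m\<^sub>i\<close> if \<open>j = i\<close>.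
  These \<open>d + 1\<close> forms of degree \<open>d\<close> satisfy the \<open>d\<close> linear relations \<open>\<ell>\<^sub>i g\<^sub>i = m\<^sub>i F\<close>, and the theorem
  says that there is nothing else: the forms generate \<open>I\<close> and the relations are a basis of the
  syzygies. Both claims are seen by reducing modulo each \<open>\<ell>\<^sub>i\<close>, which kills \<open>F\<close> and all \<open>g\<^sub>j\<close> with
  \<open>j \<noteq> i\<close>.

  Generators (\<open>vanishing_form_decomposition\<close>). A form \<open>f\<close> that vanishes on the configuration has \<open>d\<close>
  distinct zeros on \<open>L\<^sub>i\<close>, and \<open>g\<^sub>i\<close> restricted to \<open>L\<^sub>i\<close> is the product of \<open>d\<close> linear forms with exactly
  these zeros. So \<open>f = u\<^sub>i g\<^sub>i + w\<^sub>i \<ell>\<^sub>i\<close>, and \<open>f - \<Sum>\<^sub>j u\<^sub>j g\<^sub>j\<close> is divisible by every \<open>\<ell>\<^sub>i\<close>. The \<open>\<ell>\<^sub>i\<close> are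
  pairwise non-associated primes, so the difference is a multiple of \<open>F\<close>.

  Syzygies (\<open>syzygies\<close>). If \<open>u\<^sub>0 F + \<Sum>\<^sub>i u\<^sub>i g\<^sub>i = 0\<close>, then \<open>\<ell>\<^sub>i\<close> divides \<open>u\<^sub>i g\<^sub>i\<close>, hence \<open>u\<^sub>i = \<ell>\<^sub>i w\<^sub>i\<close>;
  substituting \<open>\<ell>\<^sub>i g\<^sub>i = m\<^sub>i F\<close> and cancelling \<open>F\<close> gives \<open>u\<^sub>0 = - \<Sum>\<^sub>i m\<^sub>i w\<^sub>i\<close>.

  It remains to see that every minimal resolution has the same degrees as this one. If two matrices
  have the same column module and neither has a syzygy with a nonzero constant term, then writing
  each in terms of the other and passing to constant terms gives mutually inverse matrices over the
  field (\<open>minimal_columns_unique\<close>). The numbers of columns then agree, and comparing homogeneous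
  components shows that the degrees agree and that the change of basis may be taken constant. A
  constant change of basis carries the linear syzygies along, so the argument applies a second time
  to the first differential (\<open>minimal_free_resolution_degrees\<close>).
\<close>

section \<open>The coordinate ring and substitution\<close>

lemma coord_ring_expand:
  fixes f :: "'k::field coord_ring"
  shows "f = (\<Sum>m\<in>Poly_Mapping.keys f. Poly_Mapping.single m (poly_mapping.lookup f m))"
  by (rule poly_mapping_eqI)
     (auto simp: lookup_sum lookup_single when_def in_keys_iff)

lemma coord_ring_induct [case_names single add]:
  fixes f :: "'k::field coord_ring"
  assumes single: "\<And>m c. P (Poly_Mapping.single m c)"
    and add: "\<And>f g. P f \<Longrightarrow> P g \<Longrightarrow> P (f + g)"
  shows "P f"
proof -
  have "P (\<Sum>m\<in>A. Poly_Mapping.single m (poly_mapping.lookup f m))" if "finite A" for A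
    using that
  proof induction
    case empty
    show ?case using single[of 0 0] by simp
  next
    case (insert x A)
    then show ?case by (simp add: single add)
  qed
  from this[of "Poly_Mapping.keys f"] show ?thesis
    using coord_ring_expand[of f] by simp
qed

abbreviation const_poly :: "'k::field \<Rightarrow> 'k coord_ring" where
  "const_poly c \<equiv> Poly_Mapping.single 0 c"

lemma const_poly_add: "const_poly (a + b) = const_poly a + const_poly b"
  by (simp add: single_add)

lemma const_poly_mult: "const_poly (a * b) = const_poly a * const_poly b"
  by (simp add: mult_single)

lemma const_poly_power: "const_poly (a ^ n) = const_poly a ^ n"
  by (induction n) (simp_all add: const_poly_mult)

lemma UNIV_3_shift: "(UNIV :: 3 set) = {k, k + 1, k + 2}"
  and distinct_shift: "k \<noteq> k + 1" "k \<noteq> k + 2" "k + 1 \<noteq> k + 2"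
proof -
  show d: "k \<noteq> k + 1" "k \<noteq> k + 2" "k + 1 \<noteq> k + 2" by simp_all
  have "card {k, k + 1, k + 2 :: 3} = 3" using d by simp
  moreover have "card (UNIV :: 3 set) = 3" by simp
  ultimately show "(UNIV :: 3 set) = {k, k + 1, k + 2}"
    by (metis card_subset_eq finite subset_UNIV)
qed

lemma sum_3_shift: "(\<Sum>i\<in>UNIV. f (i::3)) = f k + f (k + 1) + f (k + 2)"
  using distinct_shift[of k] by (subst UNIV_3_shift[of k]) (simp add: add.assoc)

lemma shift_3: "(i::3) + 1 + 2 = i" "(i::3) + 2 + 1 = i" "(i::3) + 1 + 1 = i + 2" "(i::3) + 2 + 2 = i + 1"
proof -
  have "(1::3) + 2 = 0" "(2::3) + 2 = 1" "(1::3) + 1 = 2" by simp_all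
  then show "(i::3) + 1 + 2 = i" "(i::3) + 2 + 1 = i" "(i::3) + 1 + 1 = i + 2" "(i::3) + 2 + 2 = i + 1"
    by (metis add.assoc add.commute add_0_right)+
qed

lemma monom_degree_add: "monom_degree (m + n) = monom_degree m + monom_degree n"
  by (simp add: monom_degree_def lookup_add sum.distrib)

lemma monom_degree_zero_iff: "monom_degree m = 0 \<longleftrightarrow> m = 0"
  by (auto simp: monom_degree_def intro: poly_mapping_eqI)

lemma single_eq_prod_variables:
  "Poly_Mapping.single m c = const_poly c * (\<Prod>i\<in>UNIV. variable i ^ poly_mapping.lookup m i)"
proof -
  have pow: "variable i ^ n = Poly_Mapping.single (Poly_Mapping.single i n) (1::'a)" for i n
    by (induction n) (simp_all add: variable_def mult_single single_add[symmetric])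
  have prod: "(\<Prod>i\<in>A. Poly_Mapping.single (e i) (1::'a)) = Poly_Mapping.single (\<Sum>i\<in>A. e i) 1"
    if "finite A" for A :: "3 set" and e :: "3 \<Rightarrow> 3 \<Rightarrow>\<^sub>0 nat"
    using that by induction (simp_all add: mult_single)
  have "(\<Sum>i\<in>UNIV. Poly_Mapping.single i (poly_mapping.lookup m i)) = m"
    by (rule poly_mapping_eqI) (simp add: lookup_sum lookup_single when_def)
  then show ?thesis
    by (simp add: pow prod mult_single)
qed

text \<open>
  The ring homomorphism that sends \<open>variable i\<close> to \<open>y i\<close> and acts on coefficients by \<open>h\<close>. Evaluation
  at a vector is the case where \<open>h\<close> is the identity; substitution of polynomials is the case where
  \<open>h\<close> is the inclusion of the constants.
\<close>

definition subst_vars :: "('k::field \<Rightarrow> 'a::comm_ring_1) \<Rightarrow> (3 \<Rightarrow> 'a) \<Rightarrow> 'k coord_ring \<Rightarrow> 'a" where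
  "subst_vars h y f = (\<Sum>m\<in>Poly_Mapping.keys f. h (poly_mapping.lookup f m) * (\<Prod>i\<in>UNIV. y i ^ poly_mapping.lookup m i))"

lemma poly_eval_eq_subst_vars: "poly_eval f v = subst_vars (\<lambda>c. c) v f"
  by (simp add: poly_eval_def subst_vars_def)

context
  fixes h :: "'k::field \<Rightarrow> 'a::comm_ring_1"
  assumes h: "comm_ring_hom h"
begin

interpretation h: comm_ring_hom h by (rule h)

lemma subst_vars_superset:
  assumes "finite A" "Poly_Mapping.keys f \<subseteq> A"
  shows "subst_vars h y f = (\<Sum>m\<in>A. h (poly_mapping.lookup f m) * (\<Prod>i\<in>UNIV. y i ^ poly_mapping.lookup m i))"
  unfolding subst_vars_def using assms
  by (intro sum.mono_neutral_left) (auto simp: in_keys_iff)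

lemma subst_vars_add: "subst_vars h y (f + g) = subst_vars h y f + subst_vars h y g"
proof -
  let ?A = "Poly_Mapping.keys f \<union> Poly_Mapping.keys g"
  have "Poly_Mapping.keys (f + g) \<subseteq> ?A" by (rule keys_add)
  then show ?thesis
    by (simp add: subst_vars_superset[of ?A] lookup_add h.hom_add distrib_right sum.distrib)
qed

lemma subst_vars_single:
  "subst_vars h y (Poly_Mapping.single m c) = h c * (\<Prod>i\<in>UNIV. y i ^ poly_mapping.lookup m i)"
  by (simp add: subst_vars_superset[of "{m}"])

lemma subst_vars_const: "subst_vars h y (const_poly c) = h c"
  by (simp add: subst_vars_single)

lemma subst_vars_variable: "subst_vars h y (variable i) = y i"
proof -
  have "(\<Prod>j\<in>UNIV. y j ^ poly_mapping.lookup (Poly_Mapping.single i 1) j)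
      = (\<Prod>j\<in>UNIV. if j = i then y i else 1)"
    by (rule prod.cong) (auto simp: lookup_single when_def)
  then show ?thesis
    by (simp add: variable_def subst_vars_single)
qed

lemma subst_vars_mult: "subst_vars h y (f * g) = subst_vars h y f * subst_vars h y g"
proof (induction f rule: coord_ring_induct)
  case (single m c)
  show ?case
  proof (induction g rule: coord_ring_induct)
    case (single n e)
    show ?case
      by (simp add: mult_single subst_vars_single lookup_add power_add prod.distrib h.hom_mult ac_simps)
  next
    case (add f g)
    then show ?case by (simp add: distrib_left subst_vars_add)
  qed
next
  case (add f g)
  then show ?case by (simp add: distrib_right subst_vars_add)
qed

lemma comm_ring_hom_subst_vars: "comm_ring_hom (subst_vars h y)"
proof
  show "subst_vars h y 1 = 1" using subst_vars_const[of y 1] by simp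
  show "subst_vars h y 0 = 0" by (simp add: subst_vars_def)
qed (simp_all add: subst_vars_add subst_vars_mult)

end

lemma comm_ring_hom_const_poly: "comm_ring_hom (const_poly :: 'k::field \<Rightarrow> _)"
  by unfold_locales (simp_all add: const_poly_add const_poly_mult)

lemma comm_ring_hom_ident: "comm_ring_hom (\<lambda>c::'k::field. c)"
  by unfold_locales simp_all

lemma comm_ring_hom_poly_eval: "comm_ring_hom (\<lambda>f. poly_eval f v)"
  unfolding poly_eval_eq_subst_vars
  by (rule comm_ring_hom_subst_vars[OF comm_ring_hom_ident])

interpretation poly_eval: comm_ring_hom "\<lambda>f. poly_eval f v" for v :: "3 \<Rightarrow> 'k::field"
  by (rule comm_ring_hom_poly_eval)

interpretation subst: comm_ring_hom "subst_vars const_poly y" for y :: "3 \<Rightarrow> 'k::field coord_ring"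
  by (rule comm_ring_hom_subst_vars[OF comm_ring_hom_const_poly])

lemma poly_eval_const [simp]: "poly_eval (const_poly c) v = c"
  by (simp add: poly_eval_eq_subst_vars subst_vars_const[OF comm_ring_hom_ident])

lemma poly_eval_variable [simp]: "poly_eval (variable i) v = v i"
  by (simp add: poly_eval_eq_subst_vars subst_vars_variable[OF comm_ring_hom_ident])

lemma poly_eval_origin: "poly_eval f (\<lambda>_. 0) = poly_mapping.lookup f 0"
proof (induction f rule: coord_ring_induct)
  case (single m c)
  have "(\<Prod>i\<in>UNIV. (0::'a) ^ poly_mapping.lookup m i) = (if m = 0 then 1 else 0)"
    using monom_degree_zero_iff[of m] by (auto simp: monom_degree_def)
  then show ?case
    by (simp add: poly_eval_eq_subst_vars subst_vars_single[OF comm_ring_hom_ident] lookup_single)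
next
  case (add f g)
  then show ?case by (simp add: poly_eval.hom_add lookup_add)
qed

lemma module_times: "Modules.module ((*) :: 'a::comm_ring_1 \<Rightarrow> 'a \<Rightarrow> 'a)"
  by unfold_locales (simp_all add: algebra_simps)

abbreviation is_ideal :: "'a::comm_ring_1 set \<Rightarrow> bool" where
  "is_ideal J \<equiv> Modules.module.subspace (*) J"

lemmas is_ideal_def = Modules.module.subspace_def[OF module_times]
lemmas is_ideal_0 = Modules.module.subspace_0[OF module_times]
lemmas is_ideal_add = Modules.module.subspace_add[OF module_times]
lemmas is_ideal_mult = Modules.module.subspace_scale[OF module_times]

text \<open>
  The map \<open>R \<rightarrow> R/J\<close> is determined by the classes of the variables. This is what makes quotient rings
  dispensable below: a congruence modulo an ideal is replaced by a substitution whose value is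
  congruent to the original polynomial.
\<close>

lemma subst_vars_cong_modulo:
  fixes f :: "'k::field coord_ring"
  assumes J: "is_ideal J" and y: "\<And>i. variable i - y i \<in> J"
  shows "f - subst_vars const_poly y f \<in> J"
proof -
  have mult: "u * u' - w * w' \<in> J" if "u - w \<in> J" "u' - w' \<in> J" for u w u' w'
  proof -
    have "u * u' - w * w' = u' * (u - w) + w * (u' - w')" by (simp add: algebra_simps)
    then show ?thesis
      using that J by (simp add: is_ideal_add is_ideal_mult)
  qed
  have zero: "0 \<in> J" using J by (rule is_ideal_0)
  have pow: "u ^ n - w ^ n \<in> J" if "u - w \<in> J" for u w n
    by (induction n) (simp_all add: zero mult that)
  have prod: "(\<Prod>i\<in>A. variable i ^ m i) - (\<Prod>i\<in>A. y i ^ m i) \<in> J" if "finite A" for A m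
    using that by induction (simp_all add: zero mult pow y)
  show ?thesis
  proof (induction f rule: coord_ring_induct)
    case (single m c)
    have "Poly_Mapping.single m c - subst_vars const_poly y (Poly_Mapping.single m c) =
      const_poly c * ((\<Prod>i\<in>UNIV. variable i ^ poly_mapping.lookup m i) - (\<Prod>i\<in>UNIV. y i ^ poly_mapping.lookup m i))"
      by (simp add: subst_vars_single[OF comm_ring_hom_const_poly] right_diff_distrib single_eq_prod_variables[symmetric])
    then show ?case
      using J prod by (simp add: is_ideal_mult)
  next
    case (add f g)
    have "f + g - subst_vars const_poly y (f + g) = (f - subst_vars const_poly y f) + (g - subst_vars const_poly y g)"
      by (simp add: subst.hom_add)
    then show ?case using add J by (simp only: is_ideal_add)
  qed
qed

section \<open>Homogeneous components\<close>

lemma homogeneous_zero: "homogeneous n 0"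
  by (simp add: homogeneous_def)

lemma homogeneous_single: "homogeneous (int (monom_degree m)) (Poly_Mapping.single m c)"
  by (simp add: homogeneous_def)

lemma homogeneous_add: "homogeneous n f \<Longrightarrow> homogeneous n g \<Longrightarrow> homogeneous n (f + g)"
  using keys_add[of f g] by (auto simp: homogeneous_def)

lemma homogeneous_sum: "(\<And>i. i \<in> A \<Longrightarrow> homogeneous n (f i)) \<Longrightarrow> homogeneous n (sum f A)"
  by (induction A rule: infinite_finite_induct) (simp_all add: homogeneous_zero homogeneous_add)

lemma homogeneous_mult: 
  assumes "homogeneous n f" "homogeneous k g" shows "homogeneous (n + k) (f * g)"
  using keys_mult[of f g] assms by (fastforce simp: homogeneous_def monom_degree_add)

lemma homogeneous_const: "homogeneous 0 (const_poly c)"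
  using homogeneous_single[of 0 c] by (simp add: monom_degree_def)

lemma homogeneous_uminus: "homogeneous n f \<Longrightarrow> homogeneous n (- f)"
  by (auto simp: homogeneous_def in_keys_iff)

lemma homogeneous_prod: "finite A \<Longrightarrow> (\<And>i. i \<in> A \<Longrightarrow> homogeneous 1 (f i)) \<Longrightarrow> homogeneous (int (card A)) (prod f A)"
proof (induction A rule: finite_induct)
  case empty
  show ?case using homogeneous_const[of 1] by simp
next
  case (insert x A)
  then show ?case
    using homogeneous_mult[of 1 "f x" "int (card A)" "prod f A"] by simp
qed

lemma homogeneous_variable: "homogeneous 1 (variable i)"
  by (simp add: homogeneous_def variable_def monom_degree_def lookup_single when_def)

definition component :: "int \<Rightarrow> 'k::field coord_ring \<Rightarrow> 'k coord_ring" where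
  "component n f = Poly_Mapping.mapp (\<lambda>m c. c when int (monom_degree m) = n) f"

lemma lookup_component:
  "poly_mapping.lookup (component n f) m = (poly_mapping.lookup f m when int (monom_degree m) = n)"
  by (auto simp: component_def lookup_mapp when_def in_keys_iff)

lemma homogeneous_component: "homogeneous n (component n f)"
  by (auto simp: homogeneous_def in_keys_iff lookup_component when_def split: if_splits)

lemma component_homogeneous:
  assumes "homogeneous k f" shows "component n f = (if n = k then f else 0)"
  using assms by (intro poly_mapping_eqI) (auto simp: lookup_component homogeneous_def when_def in_keys_iff)

lemma component_add: "component n (f + g) = component n f + component n g"
  by (intro poly_mapping_eqI) (simp add: lookup_component lookup_add when_def)

lemma component_zero [simp]: "component n 0 = 0"
  by (intro poly_mapping_eqI) (simp add: lookup_component)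

lemma component_sum: "component n (sum f A) = (\<Sum>i\<in>A. component n (f i))"
  by (induction A rule: infinite_finite_induct) (simp_all add: component_add)

lemma component_neg: "n < 0 \<Longrightarrow> component n f = 0"
  by (intro poly_mapping_eqI) (simp add: lookup_component when_def)

lemma component_zero_eq_const: "component 0 f = const_poly (poly_mapping.lookup f 0)"
  by (intro poly_mapping_eqI) (auto simp: lookup_component lookup_single when_def monom_degree_zero_iff)

text \<open>
  Multiplication by a form shifts components. Hence in an equation with homogeneous data the
  unknown coefficients may be replaced by their components of the expected degree, and a coefficient
  in degree \<open>0\<close> is its constant term.
\<close>

lemma component_mult:
  assumes q: "homogeneous e q"
  shows "component n (f * q) = component (n - e) f * q"
proof (induction f rule: coord_ring_induct)
  case (single m c)
  show ?case
    using component_homogeneous[OF homogeneous_mult[OF homogeneous_single[of m c] q], of n]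
      component_homogeneous[OF homogeneous_single[of m c], of "n - e"]
    by (auto simp: algebra_simps)
next
  case (add f g)
  then show ?case by (simp add: distrib_right component_add)
qed

section \<open>Linear forms and points\<close>

definition linear_form :: "(3 \<Rightarrow> 'k::field) \<Rightarrow> 'k coord_ring" where
  "linear_form a = (\<Sum>i\<in>UNIV. const_poly (a i) * variable i)"

definition dot :: "(3 \<Rightarrow> 'k::field) \<Rightarrow> (3 \<Rightarrow> 'k) \<Rightarrow> 'k" where
  "dot a v = (\<Sum>i\<in>UNIV. a i * v i)"

text \<open>
  The cross product, with the indices read modulo \<open>3\<close>. It represents the point of intersection of
  the two lines with coefficient vectors \<open>a\<close> and \<open>b\<close>.
\<close>

definition cross :: "(3 \<Rightarrow> 'k::field) \<Rightarrow> (3 \<Rightarrow> 'k) \<Rightarrow> 3 \<Rightarrow> 'k" where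
  "cross a b i = a (i + 1) * b (i + 2) - a (i + 2) * b (i + 1)"

lemma poly_eval_linear_form [simp]: "poly_eval (linear_form a) v = dot a v"
  by (simp add: linear_form_def dot_def poly_eval.hom_sum poly_eval.hom_mult)

lemma homogeneous_linear_form: "homogeneous 1 (linear_form a)"
  unfolding linear_form_def
  using homogeneous_mult[OF homogeneous_const homogeneous_variable]
  by (intro homogeneous_sum) simp

lemma linear_form_in_irrelevant_ideal: "linear_form a \<in> irrelevant_ideal"
  unfolding linear_form_def irrelevant_ideal_def ideal_generated_def
  by (intro Modules.module.span_sum[OF module_times] Modules.module.span_scale[OF module_times] Modules.module.span_base[OF module_times]) auto

lemma irrelevant_ideal_constant_term:
  assumes "f \<in> irrelevant_ideal" shows "poly_mapping.lookup f 0 = 0"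
proof -
  have "is_ideal {f. poly_eval f (\<lambda>_. 0) = 0}"
    by (simp add: is_ideal_def poly_eval.hom_add poly_eval.hom_mult)
  then have "irrelevant_ideal \<subseteq> {f. poly_eval f (\<lambda>_. 0) = (0::'a)}"
    unfolding irrelevant_ideal_def ideal_generated_def
    by (intro Modules.module.span_minimal[OF module_times]) auto
  then have "poly_eval f (\<lambda>_. 0) = 0" using assms by auto
  then show ?thesis by (simp add: poly_eval_origin)
qed

lemma sum_3: "(\<Sum>i\<in>UNIV. f (i::3)) = f 0 + f 1 + f 2"
  using sum_3_shift[of f 0] by simp

lemma cross_explicit:
  "cross a b 0 = a 1 * b 2 - a 2 * b 1"
  "cross a b 1 = a 2 * b 0 - a 0 * b 2"
  "cross a b 2 = a 0 * b 1 - a 1 * b 0"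
proof -
  have "(0::3) + 1 = 1" "(0::3) + 2 = 2" "(1::3) + 1 = 2" "(1::3) + 2 = 0" "(2::3) + 1 = 0" "(2::3) + 2 = 1"
    by simp_all
  then show "cross a b 0 = a 1 * b 2 - a 2 * b 1"
    "cross a b 1 = a 2 * b 0 - a 0 * b 2"
    "cross a b 2 = a 0 * b 1 - a 1 * b 0"
    unfolding cross_def by (simp_all only:)
qed

lemma dot_cross_left: "dot a (cross a b) = 0"
  and dot_cross_right: "dot b (cross a b) = 0"
  unfolding dot_def sum_3 cross_explicit by (simp_all add: algebra_simps)

lemma dot_cross_rotate: "dot a (cross b c) = dot b (cross c a)"
  unfolding dot_def sum_3 cross_explicit by (simp add: algebra_simps)

lemma cross_anticomm: "cross b a i = - cross a b i"
  by (simp add: cross_def)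

lemma dot_cross_swap: "dot c (cross b a) = - dot c (cross a b)"
  by (simp add: dot_def cross_anticomm[of b a] sum_negf)

lemma dot_scale: "dot a (\<lambda>i. c * v i) = c * dot a v"
  by (simp add: dot_def sum_distrib_left mult.left_commute)

lemma dot_zero: "dot a (\<lambda>_. 0) = 0"
  by (simp add: dot_def)

text \<open>
  The substitution solves \<open>\<ell> = 0\<close> for the variable \<open>x\<^sub>k\<close> and so realises reduction modulo \<open>\<ell>\<close> as an
  endomorphism of the polynomial ring. As that ring is a domain, \<open>\<ell>\<close> is prime.
\<close>

lemma linear_form_dvd_iff:
  assumes k: "a k \<noteq> 0"
  defines "y \<equiv> (\<lambda>i. if i = k then variable k - const_poly (1 / a k) * linear_form a else variable i)"
  shows "linear_form a dvd f \<longleftrightarrow> subst_vars const_poly y f = 0"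
proof
  have "subst_vars const_poly y (linear_form a) = (\<Sum>i\<in>UNIV. const_poly (a i) * y i)"
    by (simp add: linear_form_def subst.hom_sum subst.hom_mult subst_vars_const[OF comm_ring_hom_const_poly]
        subst_vars_variable[OF comm_ring_hom_const_poly])
  also have "\<dots> = (\<Sum>i\<in>UNIV. const_poly (a i) * variable i -
      (if i = k then linear_form a else 0))"
  proof (rule sum.cong)
    fix i
    have "const_poly (a k) * (const_poly (1 / a k) * linear_form a) = linear_form a"
      using k by (simp add: mult.assoc[symmetric] mult_single)
    then show "const_poly (a i) * y i = const_poly (a i) * variable i - (if i = k then linear_form a else 0)"
      by (simp add: y_def right_diff_distrib)
  qed simp
  also have "\<dots> = 0"
    by (simp add: sum_subtractf linear_form_def)
  finally have zero: "subst_vars const_poly y (linear_form a) = 0" .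
  show "subst_vars const_poly y f = 0" if "linear_form a dvd f"
    using that zero by (auto simp: subst.hom_mult)
  show "linear_form a dvd f" if "subst_vars const_poly y f = 0"
  proof -
    have "is_ideal {u. linear_form a dvd u}"
      by (auto simp: is_ideal_def)
    moreover have "variable i - y i \<in> {u. linear_form a dvd u}" for i
      by (simp add: y_def)
    ultimately have "f - subst_vars const_poly y f \<in> {u. linear_form a dvd u}"
      by (rule subst_vars_cong_modulo)
    then show ?thesis using that by simp
  qed
qed

lemma linear_form_dvd_mult:
  fixes f g :: "'k::field coord_ring"
  assumes a: "a \<noteq> (\<lambda>_. 0)" and dvd: "linear_form a dvd f * g"
  shows "linear_form a dvd f \<or> linear_form a dvd g"
proof -
  obtain k where k: "a k \<noteq> 0" using a by auto
  show ?thesis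
    using dvd unfolding linear_form_dvd_iff[of a k, OF k] by (simp add: subst.hom_mult)
qed

lemma linear_form_not_dvd:
  assumes "dot a v = 0" "poly_eval f v \<noteq> 0" shows "\<not> linear_form a dvd f"
  using assms by (auto simp: poly_eval.hom_mult)

lemma linear_form_nonzero: 
  assumes "a \<noteq> (\<lambda>_. 0)" shows "linear_form a \<noteq> 0"
proof
  assume z: "linear_form a = 0"
  obtain k where k: "a k \<noteq> 0" using assms by auto
  have "dot a (\<lambda>i. if i = k then 1 else 0) = a k"
    by (simp add: dot_def if_distrib[of "\<lambda>x. _ * x"] cong: if_cong)
  then show False using k z poly_eval_linear_form[of a "\<lambda>i. if i = k then 1 else 0"] by (simp add: poly_eval.hom_zero)
qed

text \<open>
  For the point \<open>v = a \<times> b\<close> the linear forms \<open>v\<^sub>k x\<^sub>j - v\<^sub>j x\<^sub>k\<close> are combinations of the forms of the two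
  lines: their coefficient vectors are, up to sign, \<open>e \<times> (a \<times> b) = (e \<bullet> b) a - (e \<bullet> a) b\<close> for a standard
  basis vector \<open>e\<close>.
\<close>

lemma minor_in_two_lines:
  "\<exists>s t. const_poly (cross a b k) * variable j - const_poly (cross a b j) * variable k =
     const_poly s * linear_form a + const_poly t * linear_form b"
proof -
  have lin: "linear_form c = const_poly (c k) * variable k + const_poly (c (k+1)) * variable (k+1)
     + const_poly (c (k+2)) * variable (k+2)" for c :: "3 \<Rightarrow> 'a"
    by (simp add: linear_form_def sum_3_shift[of _ k])
  have "j \<in> {k, k + 1, k + 2}" using UNIV_3_shift[of k] by auto
  then consider "j = k" | "j = k + 1" | "j = k + 2" by auto
  then show ?thesis
  proof cases
    case 1
    then show ?thesis by (intro exI[of _ 0]) simp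
  next
    case 2
    have "const_poly (cross a b k) * variable j - const_poly (cross a b j) * variable k =
     const_poly (b (k+2)) * linear_form a + const_poly (- a (k + 2)) * linear_form b"
      unfolding 2 lin cross_def shift_3 single_diff single_uminus const_poly_mult by (simp add: algebra_simps)
    then show ?thesis by blast
  next
    case 3
    have "const_poly (cross a b k) * variable j - const_poly (cross a b j) * variable k =
     const_poly (- b (k+1)) * linear_form a + const_poly (a (k + 1)) * linear_form b"
      unfolding 3 lin cross_def shift_3 single_diff single_uminus const_poly_mult by (simp add: algebra_simps)
    then show ?thesis by blast
  qed
qed

text \<open>
  Modulo the two lines through the point \<open>v\<close>, every variable \<open>x\<^sub>j\<close> equals \<open>(v\<^sub>j / v\<^sub>k) x\<^sub>k\<close>. A form of
  degree \<open>n\<close> is therefore congruent to its value at \<open>v\<close> times \<open>(x\<^sub>k / v\<^sub>k)\<^sup>n\<close>.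
\<close>

lemma vanishing_at_point:
  fixes f :: "'k::field coord_ring"
  assumes f: "homogeneous n f" and zero: "poly_eval f (cross a b) = 0"
    and ab: "cross a b \<noteq> (\<lambda>_. 0)"
  obtains u w where "homogeneous (n - 1) u" "f = u * linear_form b + w * linear_form a"
proof -
  define v where "v = cross a b"
  obtain k where k: "v k \<noteq> 0" using ab by (auto simp: v_def)
  define y where "y j = const_poly (v j) * (const_poly (1 / v k) * variable k)" for j
  define J where "J = {u * linear_form b + w * linear_form a | u w. True}"
  have J: "is_ideal J"
    unfolding is_ideal_def
  proof (intro conjI ballI allI)
    show "0 \<in> J" unfolding J_def by (auto intro!: exI[of _ 0])
    show "x + y \<in> J" if xy: "x \<in> J" "y \<in> J" for x y
    proof -
      obtain u w u' w' where "x = u * linear_form b + w * linear_form a" "y = u' * linear_form b + w' * linear_form a"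
        using xy unfolding J_def by blast
      then have "x + y = (u + u') * linear_form b + (w + w') * linear_form a"
        by (simp add: algebra_simps)
      then show ?thesis by (auto simp: J_def)
    qed
    show "c * x \<in> J" if x: "x \<in> J" for c x
    proof -
      obtain u w where "x = u * linear_form b + w * linear_form a"
        using x unfolding J_def by blast
      then have "c * x = (c * u) * linear_form b + (c * w) * linear_form a"
        by (simp add: algebra_simps)
      then show ?thesis by (auto simp: J_def)
    qed
  qed
  have "variable j - y j \<in> J" for j
  proof -
    obtain s t where st: "const_poly (v k) * variable j - const_poly (v j) * variable k =
       const_poly s * linear_form a + const_poly t * linear_form b"
      using minor_in_two_lines unfolding v_def by blast
    have one: "const_poly (1 / v k) * const_poly (v k) = 1"
      using k by (simp add: mult_single)
    have "const_poly (1 / v k) * (const_poly (v k) * variable j - const_poly (v j) * variable k)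
      = (const_poly (1 / v k) * const_poly (v k)) * variable j - y j"
      unfolding y_def by (simp only: algebra_simps)
    then have "variable j - y j = const_poly (1 / v k) * (const_poly t * linear_form b + const_poly s * linear_form a)"
      by (simp only: one st) (simp add: add.commute)
    moreover have "const_poly t * linear_form b + const_poly s * linear_form a \<in> J"
      by (auto simp: J_def)
    ultimately show ?thesis
      using J by (simp add: is_ideal_mult)
  qed
  then have "f - subst_vars const_poly y f \<in> J"
    by (rule subst_vars_cong_modulo[OF J])
  moreover have "subst_vars const_poly y f = 0"
  proof -
    let ?z = "const_poly (1 / v k) * variable k"
    have "subst_vars const_poly y f =
      (\<Sum>m\<in>Poly_Mapping.keys f. const_poly (poly_mapping.lookup f m * (\<Prod>i\<in>UNIV. v i ^ poly_mapping.lookup m i)) * ?z ^ nat n)"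
      unfolding subst_vars_def
    proof (rule sum.cong[OF refl])
      fix m assume "m \<in> Poly_Mapping.keys f"
      then have "int (monom_degree m) = n" using f by (simp add: homogeneous_def)
      then have "nat n = monom_degree m" by auto
      then have "nat n = (\<Sum>i\<in>UNIV. poly_mapping.lookup m i)" by (simp add: monom_degree_def)
      then have z: "(\<Prod>i\<in>UNIV. ?z ^ poly_mapping.lookup m i) = ?z ^ nat n"
        by (simp add: power_sum)
      have c: "const_poly (\<Prod>i\<in>A. v i ^ poly_mapping.lookup m i) = (\<Prod>i\<in>A. const_poly (v i) ^ poly_mapping.lookup m i)" for A
        by (induction A rule: infinite_finite_induct) (simp_all add: const_poly_mult const_poly_power)
      have "(\<Prod>i\<in>UNIV. y i ^ poly_mapping.lookup m i) = const_poly (\<Prod>i\<in>UNIV. v i ^ poly_mapping.lookup m i) * ?z ^ nat n"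
        unfolding y_def power_mult_distrib[of "const_poly _" ?z] prod.distrib z c ..
      then show "const_poly (poly_mapping.lookup f m) * (\<Prod>i\<in>UNIV. y i ^ poly_mapping.lookup m i) =
        const_poly (poly_mapping.lookup f m * (\<Prod>i\<in>UNIV. v i ^ poly_mapping.lookup m i)) * ?z ^ nat n"
        by (simp only: const_poly_mult mult.assoc)
    qed
    also have "\<dots> = const_poly (poly_eval f v) * ?z ^ nat n"
    proof -
      have c: "const_poly (sum F A) = (\<Sum>m\<in>A. const_poly (F m))" for F :: "(3 \<Rightarrow>\<^sub>0 nat) \<Rightarrow> 'k" and A
        by (induction A rule: infinite_finite_induct) (simp_all add: const_poly_add)
      show ?thesis by (simp only: poly_eval_def c sum_distrib_right)
    qed
    finally show ?thesis using zero by (simp add: v_def)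
  qed
  ultimately obtain u w where f': "f = u * linear_form b + w * linear_form a" 
    by (auto simp: J_def)
  have "f = component n f" using component_homogeneous[OF f] by simp
  also have "\<dots> = component (n - 1) u * linear_form b + component (n - 1) w * linear_form a"
    unfolding f' by (simp add: component_add component_mult[OF homogeneous_linear_form])
  finally show thesis
    using that homogeneous_component by blast
qed

text \<open>
  The points \<open>a \<times> b\<^sub>j\<close> lie on the line with form \<open>linear_form a\<close>, and the other lines \<open>b\<^sub>j\<close> cut them out
  there. They can be split off one at a time: if \<open>f\<close> is \<open>u\<close> times the product of the forms for the points
  treated so far, modulo the line, then that product does not vanish at the next point, so \<open>u\<close> does.
\<close>

lemma vanishing_on_line_points:
  fixes f :: "'k::field coord_ring" and b :: "'i \<Rightarrow> 3 \<Rightarrow> 'k"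
  assumes "finite A" and f: "homogeneous n f"
    and "\<And>j. j \<in> A \<Longrightarrow> poly_eval f (cross a (b j)) = 0"
    and "\<And>j. j \<in> A \<Longrightarrow> cross a (b j) \<noteq> (\<lambda>_. 0)"
    and "\<And>j k. j \<in> A \<Longrightarrow> k \<in> A \<Longrightarrow> j \<noteq> k \<Longrightarrow> dot (b j) (cross a (b k)) \<noteq> 0"
  shows "\<exists>u w. homogeneous (n - int (card A)) u \<and> f = u * (\<Prod>j\<in>A. linear_form (b j)) + w * linear_form a"
  using assms(1,3-)
proof (induction A rule: finite_induct)
  case empty
  show ?case using f by (intro exI[of _ f] exI[of _ 0]) simp
next
  case (insert k A)
  obtain u w where u: "homogeneous (n - int (card A)) u"
    and fu: "f = u * (\<Prod>j\<in>A. linear_form (b j)) + w * linear_form a"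
    using insert by auto
  let ?v = "cross a (b k)"
  have "poly_eval u ?v * (\<Prod>j\<in>A. dot (b j) ?v) = 0"
    using insert.prems(1)[of k] by (simp add: fu poly_eval.hom_add poly_eval.hom_mult poly_eval.hom_prod dot_cross_left)
  moreover have "(\<Prod>j\<in>A. dot (b j) ?v) \<noteq> 0"
    using insert.hyps insert.prems(3)[of _ k] by (simp) blast
  ultimately have "poly_eval u ?v = 0" by simp
  then obtain u' w' where u': "homogeneous (n - int (card A) - 1) u'" "u = u' * linear_form (b k) + w' * linear_form a"
    using vanishing_at_point[OF u, of a "b k"] insert.prems(2) by auto
  have "f = u' * (\<Prod>j\<in>insert k A. linear_form (b j)) + (w' * (\<Prod>j\<in>A. linear_form (b j)) + w) * linear_form a"
    using insert.hyps by (simp add: fu u'(2) algebra_simps)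
  moreover have "homogeneous (n - int (card (insert k A))) u'"
    using u'(1) insert.hyps by (simp add: algebra_simps)
  ultimately show ?case by blast
qed

section \<open>Uniqueness of minimal generators\<close>

lemma mat_image_subset_factor:
  fixes P Q :: "'a::comm_ring_1 mat"
  assumes P: "P \<in> carrier_mat r s" and Q: "Q \<in> carrier_mat r t"
    and sub: "mat_image P \<subseteq> mat_image Q"
  obtains A where "A \<in> carrier_mat t s" "P = Q * A"
proof -
  have "\<exists>w. w \<in> carrier_vec t \<and> Q *\<^sub>v w = col P k" if "k < s" for k
  proof -
    have "col P k = P *\<^sub>v unit_vec s k"
      using P that by (intro eq_vecI) auto
    then have "col P k \<in> mat_image P"
      using P by (auto simp: mat_image_def)
    then have "col P k \<in> mat_image Q" using sub by blast
    then show ?thesis using Q by (auto simp: mat_image_def)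
  qed
  then obtain w where w: "\<And>k. k < s \<Longrightarrow> w k \<in> carrier_vec t \<and> Q *\<^sub>v w k = col P k"
    by metis
  let ?A = "mat_of_cols t (map w [0..<s])"
  have A: "?A \<in> carrier_mat t s" by auto
  have "P = Q * ?A"
  proof (rule eq_matI)
    fix i k assume "i < dim_row (Q * ?A)" "k < dim_col (Q * ?A)"
    then have ik: "i < r" "k < s" using Q A by auto
    have "(Q * ?A) $$ (i, k) = row Q i \<bullet> col ?A k" using ik Q A by simp
    also have "col ?A k = w k" using ik w[of k] by (subst col_mat_of_cols) auto
    also have "row Q i \<bullet> w k = (Q *\<^sub>v w k) $ i" using ik Q by simp
    also have "\<dots> = P $$ (i, k)" using ik w P by simp
    finally show "P $$ (i, k) = (Q * ?A) $$ (i, k)" ..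
  qed (use P Q A in auto)
  then show thesis using that A by blast
qed

text \<open>
  A left inverse of a matrix with fewer rows than columns would, after padding both matrices with
  zeros to square ones, be the inverse of a matrix with a zero row, whose determinant is \<open>0\<close>.
\<close>

lemma left_inverse_imp_le:
  fixes A B :: "'a::field mat"
  assumes A: "A \<in> carrier_mat t s" and B: "B \<in> carrier_mat s t" and BA: "B * A = 1\<^sub>m s"
  shows "s \<le> t"
proof (rule ccontr)
  assume "\<not> s \<le> t"
  then have st: "t < s" by simp
  let ?A = "mat s s (\<lambda>(i, j). if i < t then A $$ (i, j) else 0)"
  let ?B = "mat s s (\<lambda>(i, j). if j < t then B $$ (i, j) else 0)"
  have "?B * ?A = 1\<^sub>m s"
  proof (rule eq_matI)
    fix i j assume "i < dim_row (1\<^sub>m s :: 'a mat)" "j < dim_col (1\<^sub>m s :: 'a mat)"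
    then have ij: "i < s" "j < s" by auto
    have "(?B * ?A) $$ (i, j) = (\<Sum>k<s. if k < t then B $$ (i, k) * A $$ (k, j) else 0)"
      using ij by (auto simp: scalar_prod_def lessThan_atLeast0 intro!: sum.cong)
    also have "\<dots> = (\<Sum>k<t. B $$ (i, k) * A $$ (k, j))"
      using st by (intro sum.mono_neutral_cong_right) auto
    also have "\<dots> = (B * A) $$ (i, j)"
      using ij A B by (auto simp: scalar_prod_def lessThan_atLeast0)
    finally show "(?B * ?A) $$ (i, j) = 1\<^sub>m s $$ (i, j)" by (simp add: BA)
  qed auto
  moreover have "det ?A = 0"
  proof -
    have "?A = mat\<^sub>r s s (\<lambda>i. if i = t then 0\<^sub>v s else row ?A i)"
      by (intro eq_matI) auto
    then show ?thesis
      using det_row_0[OF st, of "\<lambda>i. row ?A i"] by auto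
  qed
  ultimately have "det (1\<^sub>m s :: 'a mat) = 0"
    using det_mult[of ?B s ?A] by auto
  then show False by simp
qed

abbreviation constant_term :: "'k::field coord_ring \<Rightarrow> 'k" where
  "constant_term f \<equiv> poly_mapping.lookup f 0"

lemma comm_ring_hom_constant_term: "comm_ring_hom constant_term"
  using comm_ring_hom_poly_eval[of "\<lambda>_. 0"] by (simp add: poly_eval_origin)

interpretation constant_term: comm_ring_hom constant_term
  by (rule comm_ring_hom_constant_term)

interpretation const_poly: comm_ring_hom const_poly
  by (rule comm_ring_hom_const_poly)

text \<open>
  By Nakayama's lemma the columns of a graded matrix minimally generate their span exactly when the
  coefficients of every relation between them lie in the irrelevant ideal.
\<close>

definition minimal_columns :: "'k::field coord_ring mat \<Rightarrow> bool" where
  "minimal_columns P \<longleftrightarrow> (\<forall>v\<in>mat_kernel P. \<forall>k<dim_col P. constant_term (v $ k) = 0)"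

text \<open>The columns of \<open>1 - C\<close> are relations between the columns of \<open>P\<close>.\<close>

lemma minimal_columns_fix:
  assumes P: "P \<in> carrier_mat r s" and C: "C \<in> carrier_mat s s"
    and fix_P: "P * C = P" and minP: "minimal_columns P"
  shows "map_mat constant_term C = 1\<^sub>m s"
proof (rule eq_matI)
  fix i j assume "i < dim_row (1\<^sub>m s :: 'a mat)" "j < dim_col (1\<^sub>m s :: 'a mat)"
  then have ij: "i < s" "j < s" by auto
  let ?v = "unit_vec s j - col C j"
  have "P *\<^sub>v ?v = P *\<^sub>v unit_vec s j - P *\<^sub>v col C j"
    using P C ij by (intro mult_minus_distrib_mat_vec) auto
  also have "P *\<^sub>v unit_vec s j = col P j"
    using P ij by (intro eq_vecI) auto
  also have "P *\<^sub>v col C j = col (P * C) j"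
    using col_mult2[OF P C ij(2)] by simp
  finally have "P *\<^sub>v ?v = 0\<^sub>v r"
    using P ij by (simp add: fix_P)
  then have "?v \<in> mat_kernel P"
    using P C ij by (intro mat_kernelI[OF P]) auto
  then have "constant_term (?v $ i) = 0"
    using minP P ij by (metis minimal_columns_def carrier_matD(2))
  then show "map_mat constant_term C $$ (i, j) = 1\<^sub>m s $$ (i, j)"
    using C ij by (auto simp: lookup_minus split: if_splits)
qed (use C in auto)

text \<open>
  Write \<open>P = Q A'\<close> and \<open>Q = P B'\<close>. Then \<open>P = P B' A'\<close> and \<open>Q = Q A' B'\<close>, so the constant terms of \<open>A'\<close>
  and \<open>B'\<close> are inverse to each other. The component of degree \<open>e\<close> of \<open>P = Q A'\<close> involves only the
  constant terms of \<open>A'\<close>. If a column of \<open>P\<close> had another degree, this component would be zero, and the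
  corresponding column of constant terms would be a relation between the columns of \<open>Q\<close>, hence zero.
\<close>

lemma minimal_columns_unique:
  fixes P Q :: "'k::field coord_ring mat"
  assumes P: "P \<in> carrier_mat r s" and Q: "Q \<in> carrier_mat r t"
    and image: "mat_image P = mat_image Q"
    and minP: "minimal_columns P" and minQ: "minimal_columns Q"
    and homP: "\<And>i k. i < r \<Longrightarrow> k < s \<Longrightarrow> homogeneous (c k) (P $$ (i, k))"
    and homQ: "\<And>i k. i < r \<Longrightarrow> k < t \<Longrightarrow> homogeneous e (Q $$ (i, k))"
  obtains A B where "s = t" "\<And>k. k < s \<Longrightarrow> c k = e"
    "A \<in> carrier_mat t t" "B \<in> carrier_mat t t" "P = Q * A" "A * B = 1\<^sub>m t" "B * A = 1\<^sub>m t"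
    "\<And>i k. i < t \<Longrightarrow> k < t \<Longrightarrow> homogeneous 0 (B $$ (i, k))"
proof -
  obtain A' where A': "A' \<in> carrier_mat t s" "P = Q * A'"
    using mat_image_subset_factor[OF P Q] image by blast
  obtain B' where B': "B' \<in> carrier_mat s t" "Q = P * B'"
    using mat_image_subset_factor[OF Q P] image by blast
  define A0 where "A0 = map_mat constant_term A'"
  define B0 where "B0 = map_mat constant_term B'"
  have A0: "A0 \<in> carrier_mat t s" and B0: "B0 \<in> carrier_mat s t"
    using A'(1) B'(1) by (auto simp: A0_def B0_def)
  have "P * (B' * A') = P"
    using assoc_mult_mat[OF P B'(1) A'(1)] unfolding B'(2)[symmetric] A'(2)[symmetric] by (rule sym)
  then have "map_mat constant_term (B' * A') = 1\<^sub>m s"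
    by (rule minimal_columns_fix[OF P mult_carrier_mat[OF B'(1) A'(1)] _ minP])
  then have BA: "B0 * A0 = 1\<^sub>m s"
    unfolding A0_def B0_def using constant_term.mat_hom_mult[OF B'(1) A'(1)] by simp
  have "Q * (A' * B') = Q"
    using assoc_mult_mat[OF Q A'(1) B'(1)] unfolding A'(2)[symmetric] B'(2)[symmetric] by (rule sym)
  then have "map_mat constant_term (A' * B') = 1\<^sub>m t"
    by (rule minimal_columns_fix[OF Q mult_carrier_mat[OF A'(1) B'(1)] _ minQ])
  then have AB: "A0 * B0 = 1\<^sub>m t"
    unfolding A0_def B0_def using constant_term.mat_hom_mult[OF A'(1) B'(1)] by simp
  have st: "s = t"
    using left_inverse_imp_le[OF A0 B0 BA] left_inverse_imp_le[OF B0 A0 AB] by simp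
  let ?A = "map_mat const_poly A0" and ?B = "map_mat const_poly B0"
  have comp: "component e (P $$ (j, k)) = (Q * ?A) $$ (j, k)" if jk: "j < r" "k < s" for j k
  proof -
    have "P $$ (j, k) = (\<Sum>i<t. A' $$ (i, k) * Q $$ (j, i))"
      unfolding A'(2) using jk Q A'(1) by (simp add: scalar_prod_def lessThan_atLeast0 mult.commute)
    then have "component e (P $$ (j, k)) = (\<Sum>i<t. component e (A' $$ (i, k) * Q $$ (j, i)))"
      by (simp add: component_sum)
    also have "\<dots> = (\<Sum>i<t. const_poly (A0 $$ (i, k)) * Q $$ (j, i))"
    proof (rule sum.cong)
      fix i assume i: "i \<in> {..<t}"
      then show "component e (A' $$ (i, k) * Q $$ (j, i)) = const_poly (A0 $$ (i, k)) * Q $$ (j, i)"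
        using component_mult[OF homQ[OF jk(1), of i], of e] A'(1) jk
        by (simp add: component_zero_eq_const A0_def)
    qed simp
    also have "\<dots> = (Q * ?A) $$ (j, k)"
      using jk Q A0 by (simp add: scalar_prod_def lessThan_atLeast0 mult.commute)
    finally show ?thesis .
  qed
  have deg: "c k = e" if k: "k < s" for k
  proof (rule ccontr)
    assume "c k \<noteq> e"
    then have "component e (P $$ (j, k)) = 0" if "j < r" for j
      using component_homogeneous[OF homP[OF that k], of e] by simp
    then have zero: "(Q * ?A) $$ (j, k) = 0" if "j < r" for j
      using comp that k by simp
    have "Q *\<^sub>v col ?A k = 0\<^sub>v r"
    proof (rule eq_vecI)
      fix j assume "j < dim_vec (0\<^sub>v r :: 'k coord_ring vec)"
      then show "(Q *\<^sub>v col ?A k) $ j = 0\<^sub>v r $ j"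
        using zero[of j] Q A0 k by simp
    qed (use Q in simp)
    then have "col ?A k \<in> mat_kernel Q"
      using A0 k by (intro mat_kernelI[OF Q]) auto
    then have "constant_term (col ?A k $ i) = 0" if "i < t" for i
      using minQ Q that by (auto simp: minimal_columns_def)
    then have "A0 $$ (i, k) = 0" if "i < t" for i
      using that A0 k by auto
    then have "(B0 * A0) $$ (k, k) = 0"
      using A0 B0 k by (simp add: scalar_prod_def)
    then show False using k by (simp add: BA)
  qed
  have "P = Q * ?A"
  proof (rule eq_matI)
    fix j k assume "j < dim_row (Q * ?A)" "k < dim_col (Q * ?A)"
    then have jk: "j < r" "k < s" using Q A0 by auto
    then show "P $$ (j, k) = (Q * ?A) $$ (j, k)"
      using comp[OF jk] component_homogeneous[OF homP[OF jk], of e] deg[of k] by simp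
  qed (use P Q A0 in auto)
  moreover have "?A * ?B = 1\<^sub>m t"
    using const_poly.mat_hom_mult[OF A0 B0] by (simp add: AB const_poly.mat_hom_one)
  moreover have "?B * ?A = 1\<^sub>m t"
    using const_poly.mat_hom_mult[OF B0 A0] by (simp add: BA const_poly.mat_hom_one st)
  moreover have "homogeneous 0 (?B $$ (i, k))" if "i < t" "k < t" for i k
    using that B0 st by (simp add: homogeneous_const)
  ultimately show thesis
    using that[of ?A ?B] st deg A0 B0 by auto
qed

lemma minimal_columnsI:
  fixes N :: "'k::field coord_ring mat"
  assumes "mat_kernel P = mat_image N" "dim_row N = dim_col P" "elements_mat N \<subseteq> {f. constant_term f = 0}"
  shows "minimal_columns P"
  unfolding minimal_columns_def
proof (intro ballI allI impI)
  fix v k assume "v \<in> mat_kernel P" and k: "k < dim_col P"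
  then obtain w where w: "v = N *\<^sub>v w" "w \<in> carrier_vec (dim_col N)"
    using assms(1) by (auto simp: mat_image_def)
  have "constant_term (N $$ (k, j)) = 0" if "j < dim_col N" for j
    using assms(2,3) that k by auto
  then show "constant_term (v $ k) = 0"
    using w k assms(2) by (simp add: scalar_prod_def lookup_sum constant_term.hom_mult)
qed

lemma minimal_columns_injective:
  assumes "mat_kernel P \<subseteq> {0\<^sub>v (dim_col P)}" shows "minimal_columns P"
  using assms unfolding minimal_columns_def by auto

section \<open>Linear resolutions of length one\<close>

text \<open>
  If the kernel of \<open>M j\<close> is zero, then \<open>M (Suc j)\<close> is zero and every unit vector is in its kernel,
  which minimality forbids.
\<close>

lemma minimal_free_resolution_trivial_step:
  fixes M :: "nat \<Rightarrow> 'k::field coord_ring mat"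
  assumes res: "minimal_free_resolution I D M" and ker: "mat_kernel (M j) \<subseteq> {0\<^sub>v (length (D j))}"
    and dim: "dim_col (M j) = length (D j)"
  shows "D (Suc j) = []"
proof (rule ccontr)
  assume ne: "D (Suc j) \<noteq> []"
  let ?n = "length (D (Suc j))"
  have M1: "M (Suc j) \<in> carrier_mat (length (D j)) ?n"
    and M2: "M (Suc (Suc j)) \<in> carrier_mat ?n (length (D (Suc (Suc j))))"
    and image: "mat_image (M (Suc j)) = mat_kernel (M j)" "mat_image (M (Suc (Suc j))) = mat_kernel (M (Suc j))"
    and irr: "elements_mat (M (Suc (Suc j))) \<subseteq> irrelevant_ideal"
    using res by (auto simp: minimal_free_resolution_def graded_free_resolution_def graded_hom_def)
  have "M (Suc j) *\<^sub>v unit_vec ?n 0 \<in> mat_image (M (Suc j))"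
    using M1 unfolding mat_image_def by auto
  then have "M (Suc j) *\<^sub>v unit_vec ?n 0 = 0\<^sub>v (length (D j))"
    using image(1) ker by blast
  then have "unit_vec ?n 0 \<in> mat_kernel (M (Suc j))"
    using M1 by (intro mat_kernelI) auto
  moreover have "minimal_columns (M (Suc j))"
    using image irr M1 M2 irrelevant_ideal_constant_term by (intro minimal_columnsI[of _ "M (Suc (Suc j))"]) auto
  ultimately have "constant_term (unit_vec ?n 0 $ 0) = (0::'k)"
    using M1 ne unfolding minimal_columns_def by (metis carrier_matD(2) length_greater_0_conv)
  then show False using ne by (simp add: lookup_one)
qed

text \<open>
  The exact sequence \<open>0 \<rightarrow> R\<^sup>u(- e - 1) \<rightarrow> R\<^sup>t(- e) \<rightarrow> I \<rightarrow> 0\<close>, with the matrices \<open>G\<close> and \<open>N\<close> of its two maps.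
\<close>

locale linear_resolution =
  fixes I :: "'k::field coord_ring set" and e :: int and t u :: nat
    and G N :: "'k coord_ring mat"
  assumes G: "G \<in> carrier_mat 1 t" and N: "N \<in> carrier_mat t u"
    and homG: "\<And>k. k < t \<Longrightarrow> homogeneous e (G $$ (0, k))"
    and homN: "\<And>i k. i < t \<Longrightarrow> k < u \<Longrightarrow> homogeneous 1 (N $$ (i, k))"
    and N_irrelevant: "elements_mat N \<subseteq> irrelevant_ideal"
    and image_G: "(\<lambda>v. v $ 0) ` mat_image G = I"
    and kernel_G: "mat_kernel G = mat_image N"
    and kernel_N: "mat_kernel N = {0\<^sub>v u}"
begin

lemma exists_minimal_free_resolution: "\<exists>D M. minimal_free_resolution I D M"
proof -
  define D where "D j = (if j = 0 then replicate t e else if j = 1 then replicate u (e + 1) else [])" for j :: nat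
  define M where "M j = (if j = 0 then G else if j = 1 then N else 0\<^sub>m (length (D (j - 1))) 0)" for j :: nat
  have D: "D 0 = replicate t e" "D (Suc 0) = replicate u (e + 1)" "\<And>j. D (Suc (Suc j)) = []"
    by (simp_all add: D_def)
  have M: "M 0 = G" "M (Suc 0) = N" "\<And>j. M (Suc (Suc j)) = 0\<^sub>m (length (D (Suc j))) 0"
    by (simp_all add: M_def)
  have image_zero: "mat_image (0\<^sub>m n 0 :: 'k coord_ring mat) = {0\<^sub>v n}" for n
  proof -
    have "0\<^sub>m n 0 *\<^sub>v v = 0\<^sub>v n" if "v \<in> carrier_vec 0" for v :: "'k coord_ring vec"
      using that by (intro eq_vecI) (auto simp: scalar_prod_def)
    then show ?thesis by (auto simp: mat_image_def intro!: exI[of _ "0\<^sub>v 0"])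
  qed
  have kernel_zero: "mat_kernel (0\<^sub>m n 0 :: 'k coord_ring mat) = {0\<^sub>v 0}" for n
  proof -
    have "0\<^sub>m n 0 *\<^sub>v 0\<^sub>v 0 = (0\<^sub>v n :: 'k coord_ring vec)"
      by (intro eq_vecI) (auto simp: scalar_prod_def)
    then show ?thesis by (auto simp: mat_kernel_def)
  qed
  have "mat_image (M (Suc j)) = mat_kernel (M j)" for j
  proof -
    consider "j = 0" | "j = Suc 0" | i where "j = Suc (Suc i)" by (metis nat.exhaust)
    then show ?thesis
      using kernel_G kernel_N by cases (simp_all add: M D image_zero kernel_zero)
  qed
  moreover have "graded_hom (D (Suc j)) (D j) (M (Suc j))" for j
    using N homN by (cases j) (auto simp: graded_hom_def D M)
  moreover have "graded_hom (D 0) [0] (M 0)"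
    using G homG by (auto simp: graded_hom_def D M)
  moreover have "\<forall>j>1. D j = []" by (simp add: D_def)
  ultimately have "graded_free_resolution I D M"
    using image_G unfolding graded_free_resolution_def by (auto simp: M(1))
  moreover have "elements_mat (M (Suc j)) \<subseteq> irrelevant_ideal" for j
    using N_irrelevant by (cases j) (auto simp: M)
  ultimately show ?thesis
    unfolding minimal_free_resolution_def by blast
qed

text \<open>
  Comparing \<open>M 0\<close> with \<open>G\<close> gives \<open>M 0 = G A\<close> with a constant invertible matrix \<open>A\<close>. The kernel of \<open>M 0\<close>
  is then the image of \<open>A\<^sup>-\<^sup>1 N\<close>, which is again injective with linear entries, so \<open>M 1\<close> can be compared
  with it in turn. It follows that \<open>M 1\<close> is injective, and the resolution stops there.
\<close>

lemma minimal_free_resolution_degrees: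
  assumes res: "minimal_free_resolution I D M"
  shows "D 0 = replicate t e \<and> D 1 = replicate u (e + 1) \<and> (\<forall>j\<ge>2. D j = [])"
proof -
  have M0: "M 0 \<in> carrier_mat 1 (length (D 0))"
    and hom0: "\<And>k. k < length (D 0) \<Longrightarrow> homogeneous (D 0 ! k) (M 0 $$ (0, k))"
    and MS: "\<And>j. M (Suc j) \<in> carrier_mat (length (D j)) (length (D (Suc j)))"
    and homS: "\<And>j i k. i < length (D j) \<Longrightarrow> k < length (D (Suc j)) \<Longrightarrow> homogeneous (D (Suc j) ! k - D j ! i) (M (Suc j) $$ (i, k))"
    and image0: "(\<lambda>v. v $ 0) ` mat_image (M 0) = I"
    and image: "\<And>j. mat_image (M (Suc j)) = mat_kernel (M j)"
    and irr: "\<And>j. elements_mat (M (Suc j)) \<subseteq> irrelevant_ideal"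
    using res by (auto simp: minimal_free_resolution_def graded_free_resolution_def graded_hom_def)
  have dimc: "dim_col (M j) = length (D j)" for j
    using M0 MS by (cases j) auto
  have min: "minimal_columns (M j)" for j
    using image[of j] irr[of j] MS[of j] dimc[of j] irrelevant_ideal_constant_term
    by (intro minimal_columnsI[of _ "M (Suc j)"]) auto
  have minG: "minimal_columns G"
    using kernel_G N_irrelevant N G irrelevant_ideal_constant_term
    by (intro minimal_columnsI[of _ N]) auto
  \<comment> \<open>The image of \<open>M 0\<close> is known only through its values in the ring; vectors of dimension one are
    determined by their entry.\<close>
  have one_dim: "mat_image P = {v \<in> carrier_vec 1. v $ 0 \<in> (\<lambda>v. v $ 0) ` mat_image P}"
    if "P \<in> carrier_mat 1 s" for P :: "'k coord_ring mat" and s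
  proof -
    have sub: "mat_image P \<subseteq> carrier_vec 1" using that by (auto simp: mat_image_def)
    have eq: "v = w" if "v \<in> carrier_vec 1" "w \<in> carrier_vec 1" "v $ 0 = w $ 0" for v w :: "'k coord_ring vec"
      using that by (intro eq_vecI) auto
    show ?thesis
    proof (intro equalityI subsetI)
      fix v assume "v \<in> {v \<in> carrier_vec 1. v $ 0 \<in> (\<lambda>v. v $ 0) ` mat_image P}"
      then obtain w where "v \<in> carrier_vec 1" "w \<in> mat_image P" "v $ 0 = w $ 0" by auto
      then show "v \<in> mat_image P" using eq[of v w] sub by auto
    qed (use sub in auto)
  qed
  have "mat_image (M 0) = mat_image G"
    using one_dim[OF M0] one_dim[OF G] image0 image_G by simp
  then obtain A B where len0: "length (D 0) = t" and deg0: "\<And>k. k < t \<Longrightarrow> D 0 ! k = e"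
    and A: "A \<in> carrier_mat t t" and B: "B \<in> carrier_mat t t" and M0_eq: "M 0 = G * A"
    and AB: "A * B = 1\<^sub>m t" and BA: "B * A = 1\<^sub>m t"
    and homB: "\<And>i k. i < t \<Longrightarrow> k < t \<Longrightarrow> homogeneous 0 (B $$ (i, k))"
    using minimal_columns_unique[OF M0 G _ min minG, of "\<lambda>k. D 0 ! k" e] hom0 homG by auto
  have BN: "B * N \<in> carrier_mat t u" using B N by auto
  have "mat_kernel (M 0) = mat_image (B * N)"
  proof (intro equalityI subsetI)
    fix v assume "v \<in> mat_kernel (M 0)"
    then have v: "v \<in> carrier_vec t" "G * A *\<^sub>v v = 0\<^sub>v 1"
      using mat_kernelD[OF M0] len0 unfolding M0_eq by auto
    then have "A *\<^sub>v v \<in> mat_kernel G"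
      using G A by (intro mat_kernelI[OF G]) auto
    then obtain w where w: "w \<in> carrier_vec u" "A *\<^sub>v v = N *\<^sub>v w"
      using N unfolding kernel_G mat_image_def by auto
    have "v = B * A *\<^sub>v v" using v BA by simp
    also have "\<dots> = B * N *\<^sub>v w"
      using assoc_mult_mat_vec[OF B A v(1)] assoc_mult_mat_vec[OF B N w(1)] w(2) by simp
    finally show "v \<in> mat_image (B * N)" using w(1) N unfolding mat_image_def by auto
  next
    fix v assume "v \<in> mat_image (B * N)"
    then obtain w where w: "w \<in> carrier_vec u" "v = B * N *\<^sub>v w"
      using BN N unfolding mat_image_def by auto
    have Nw: "N *\<^sub>v w \<in> carrier_vec t" using N w by auto
    have v: "v \<in> carrier_vec t" using w BN by auto
    have "A *\<^sub>v v = A *\<^sub>v (B *\<^sub>v (N *\<^sub>v w))"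
      using assoc_mult_mat_vec[OF B N w(1)] w(2) by simp
    also have "\<dots> = N *\<^sub>v w"
      using assoc_mult_mat_vec[OF A B Nw] AB Nw by simp
    finally have "A *\<^sub>v v \<in> mat_kernel G"
      using w(1) N unfolding kernel_G mat_image_def by auto
    then have "G * A *\<^sub>v v = 0\<^sub>v 1"
      using mat_kernelD(2)[OF G] assoc_mult_mat_vec[OF G A v] by simp
    then show "v \<in> mat_kernel (M 0)"
      using mat_kernelI[OF M0] v len0 unfolding M0_eq by simp
  qed
  then have image1: "mat_image (M (Suc 0)) = mat_image (B * N)"
    using image[of 0] by simp
  have kernel_BN: "v = 0\<^sub>v u" if "v \<in> mat_kernel (B * N)" for v
  proof -
    have v: "v \<in> carrier_vec u" "B * N *\<^sub>v v = 0\<^sub>v t"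
      using mat_kernelD[OF BN that] by auto
    have Nv: "N *\<^sub>v v \<in> carrier_vec t" using N v by auto
    have "N *\<^sub>v v = A *\<^sub>v (B *\<^sub>v (N *\<^sub>v v))"
      using assoc_mult_mat_vec[OF A B Nv] AB Nv by simp
    also have "B *\<^sub>v (N *\<^sub>v v) = 0\<^sub>v t"
      using assoc_mult_mat_vec[OF B N v(1)] unfolding v(2) by (rule sym)
    also have "A *\<^sub>v 0\<^sub>v t = 0\<^sub>v t" using A by (intro eq_vecI) auto
    finally have "v \<in> mat_kernel N" using v by (intro mat_kernelI[OF N]) auto
    then show ?thesis using kernel_N by simp
  qed
  have minBN: "minimal_columns (B * N)"
    using kernel_BN BN N by (intro minimal_columns_injective) auto
  have homBN: "homogeneous 1 ((B * N) $$ (i, k))" if "i < t" "k < u" for i k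
  proof -
    have "(B * N) $$ (i, k) = (\<Sum>j<t. B $$ (i, j) * N $$ (j, k))"
      using that B N by (simp add: scalar_prod_def lessThan_atLeast0)
    then show ?thesis
      using homogeneous_mult[OF homB homN] that by (auto intro!: homogeneous_sum)
  qed
  have M1: "M (Suc 0) \<in> carrier_mat t (length (D (Suc 0)))" using MS[of 0] len0 by simp
  have hom1: "homogeneous (D (Suc 0) ! k - e) (M (Suc 0) $$ (i, k))"
    if "i < t" "k < length (D (Suc 0))" for i k
    using homS[of i 0 k] that deg0 len0 by simp
  obtain A' B' where len1: "length (D (Suc 0)) = u"
    and deg1: "\<And>k. k < length (D (Suc 0)) \<Longrightarrow> D (Suc 0) ! k - e = 1"
    and A': "A' \<in> carrier_mat u u" and B': "B' \<in> carrier_mat u u"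
    and M1_eq: "M (Suc 0) = B * N * A'" and BA': "B' * A' = 1\<^sub>m u"
    by (rule minimal_columns_unique[OF M1 BN image1 min minBN, of "\<lambda>k. D (Suc 0) ! k - e" 1])
       (erule (1) hom1 | erule (1) homBN | (rule that; assumption))+
  have kernel1: "v = 0\<^sub>v u" if "v \<in> mat_kernel (M (Suc 0))" for v
  proof -
    have v: "v \<in> carrier_vec u" "B * N * A' *\<^sub>v v = 0\<^sub>v t"
      using mat_kernelD[OF M1 that] len1 unfolding M1_eq by auto
    then have "A' *\<^sub>v v \<in> mat_kernel (B * N)"
      using assoc_mult_mat_vec[OF BN A' v(1)] A' by (intro mat_kernelI[OF BN]) auto
    then have "A' *\<^sub>v v = 0\<^sub>v u" by (rule kernel_BN)
    then have "B' *\<^sub>v (A' *\<^sub>v v) = 0\<^sub>v u" using B' by (simp, intro eq_vecI) auto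
    then show ?thesis
      using assoc_mult_mat_vec[OF B' A' v(1)] BA' v(1) by simp
  qed
  have tail: "D (Suc (Suc j)) = []" for j
  proof (induction j)
    case 0
    show ?case
      using kernel1 len1 by (intro minimal_free_resolution_trivial_step[OF res _ dimc]) auto
  next
    case (Suc j)
    have "mat_kernel (M (Suc (Suc j))) \<subseteq> carrier_vec 0"
      using Suc mat_kernel_carrier[OF MS[of "Suc j"]] by simp
    also have "\<dots> \<subseteq> {0\<^sub>v 0}"
    proof
      fix v :: "'k coord_ring vec" assume "v \<in> carrier_vec 0"
      then have "v = 0\<^sub>v 0" by (intro eq_vecI) auto
      then show "v \<in> {0\<^sub>v 0}" by (simp only: singleton_iff)
    qed
    finally have "mat_kernel (M (Suc (Suc j))) \<subseteq> {0\<^sub>v (length (D (Suc (Suc j))))}"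
      using Suc by (simp only: list.size)
    then show ?case
      by (rule minimal_free_resolution_trivial_step[OF res _ dimc])
  qed
  have "D j = []" if "j \<ge> 2" for j
  proof -
    have "j = Suc (Suc (j - 2))" using that by simp
    then show ?thesis using tail[of "j - 2"] by simp
  qed
  moreover have "D 0 = replicate t e"
    using len0 deg0 by (intro nth_equalityI) auto
  moreover have "D (Suc 0) = replicate u (e + 1)"
  proof (rule nth_equalityI)
    fix k assume "k < length (D (Suc 0))"
    then show "D (Suc 0) ! k = replicate u (e + 1) ! k"
      using len1 deg1[of k] by simp
  qed (use len1 in simp)
  ultimately show ?thesis by simp
qed

lemma regularity_eq:
  assumes "t > 0"
  shows "regularity I = e"
proof -
  have "Max {Max (set (D j)) - int j | j. D j \<noteq> []} = e" if "minimal_free_resolution I D M" for D M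
  proof -
    have D: "D 0 = replicate t e" "D 1 = replicate u (e + 1)" "\<And>j. j \<ge> 2 \<Longrightarrow> D j = []"
      using minimal_free_resolution_degrees[OF that] by auto
    have "{Max (set (D j)) - int j | j. D j \<noteq> []} = {e}"
    proof (intro equalityI subsetI)
      fix x assume "x \<in> {Max (set (D j)) - int j | j. D j \<noteq> []}"
      then obtain j where j: "x = Max (set (D j)) - int j" "D j \<noteq> []" by auto
      then have "j < 2" using D(3)[of j] by (meson not_less)
      then have "j = 0 \<or> j = 1" by auto
      then show "x \<in> {e}" using j D by (auto simp: set_replicate_conv_if)
    next
      fix x assume "x \<in> {e}"
      then show "x \<in> {Max (set (D j)) - int j | j. D j \<noteq> []}"
        using D(1) assms by (auto simp: set_replicate_conv_if intro!: exI[of _ 0])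
    qed
    then show ?thesis by simp
  qed
  then show ?thesis
    unfolding regularity_def using exists_minimal_free_resolution by (intro the_equality) auto
qed

lemma ideal_degree_ge:
  assumes f: "f \<in> I" and m: "m \<in> Poly_Mapping.keys f"
  shows "e \<le> int (monom_degree m)"
proof (rule ccontr)
  assume "\<not> e \<le> int (monom_degree m)"
  then have n: "int (monom_degree m) < e" by simp
  obtain v where v: "v \<in> carrier_vec t" "f = (G *\<^sub>v v) $ 0"
    using f G unfolding image_G[symmetric] mat_image_def by auto
  have "f = (\<Sum>k<t. v $ k * G $$ (0, k))"
    using v G by (simp add: scalar_prod_def lessThan_atLeast0 mult.commute)
  then have "component (int (monom_degree m)) f = 0"
    using n component_mult[OF homG] by (simp add: component_sum component_neg)
  then have "poly_mapping.lookup (component (int (monom_degree m)) f) m = 0" by simp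
  then show False using m by (simp add: lookup_component in_keys_iff)
qed

lemma initial_degree_eq:
  assumes "k < t" "G $$ (0, k) \<noteq> 0" and e: "e = int d"
  shows "initial_degree I = d"
  unfolding initial_degree_def
proof (rule Least_equality)
  have deg_max: "\<exists>m\<in>Poly_Mapping.keys f. total_degree f = monom_degree m" if "f \<noteq> 0" for f :: "'k coord_ring"
  proof -
    have "Poly_Mapping.keys f \<noteq> {}" using that by simp
    then have "total_degree f \<in> monom_degree ` Poly_Mapping.keys f"
      unfolding total_degree_def by (intro Max_in) auto
    then show ?thesis by auto
  qed
  have "G *\<^sub>v unit_vec t k \<in> mat_image G"
    using G unfolding mat_image_def by auto
  moreover have "(G *\<^sub>v unit_vec t k) $ 0 = G $$ (0, k)" 
    using G assms by simp
  ultimately have "G $$ (0, k) \<in> I"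
    unfolding image_G[symmetric] by (metis imageI)
  moreover have "total_degree (G $$ (0, k)) = d"
    using deg_max[OF assms(2)] homG[OF assms(1)] e by (auto simp: homogeneous_def)
  ultimately show "\<exists>f\<in>I. f \<noteq> 0 \<and> total_degree f = d" using assms by blast
  fix n assume "\<exists>f\<in>I. f \<noteq> 0 \<and> total_degree f = n"
  then show "d \<le> n" using deg_max ideal_degree_ge e by fastforce
qed

end

section \<open>Generators and syzygies for a quasi star configuration\<close>

lemma prod_linear_forms_dvd:
  fixes f :: "'k::field coord_ring"
  assumes "finite A" "\<And>i. i \<in> A \<Longrightarrow> a i \<noteq> (\<lambda>_. 0)"
    and "\<And>i j. i \<in> A \<Longrightarrow> j \<in> A \<Longrightarrow> i \<noteq> j \<Longrightarrow> \<not> linear_form (a i) dvd linear_form (a j)"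
    and "\<And>i. i \<in> A \<Longrightarrow> linear_form (a i) dvd f"
  shows "(\<Prod>i\<in>A. linear_form (a i)) dvd f"
  using assms
proof (induction A rule: finite_induct)
  case (insert k A)
  have k: "a k \<noteq> (\<lambda>_. 0)" "\<And>j. j \<in> A \<Longrightarrow> \<not> linear_form (a k) dvd linear_form (a j)"
    using insert.prems(1,2) insert.hyps by auto
  have not_prod: "\<not> linear_form (a k) dvd (\<Prod>i\<in>B. linear_form (a i))" if "finite B" "B \<subseteq> A" for B
    using that
  proof (induction B rule: finite_induct)
    case empty
    have "dot (a k) (\<lambda>_. 0) = 0" by (rule dot_zero)
    then show ?case using linear_form_not_dvd[of "a k" _ 1] by simp
  next
    case (insert j B)
    then show ?case
      using linear_form_dvd_mult[OF k(1), of "linear_form (a j)" "\<Prod>i\<in>B. linear_form (a i)"] k(2)[of j] by auto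
  qed
  have "(\<Prod>i\<in>A. linear_form (a i)) dvd f" using insert by auto
  then obtain u where u: "f = (\<Prod>i\<in>A. linear_form (a i)) * u" by (elim dvdE)
  then have "linear_form (a k) dvd u"
    using linear_form_dvd_mult[of "a k" "\<Prod>i\<in>A. linear_form (a i)" u] insert.prems insert.hyps not_prod[of A] by auto
  then show ?case using insert.hyps u by (auto simp: mult.commute intro: mult_dvd_mono)
qed simp

text \<open>
  The configuration in coordinates: \<open>a i\<close> is the coefficient vector of the line \<open>L\<^sub>i\<close>, and the point \<open>q\<^sub>i\<close>
  is given as the intersection of \<open>L\<^sub>i\<close> with an auxiliary line \<open>b i\<close>.
\<close>

locale quasi_star_forms =
  fixes d :: nat and a b :: "nat \<Rightarrow> 3 \<Rightarrow> 'k::field"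
  assumes d: "d \<ge> 2"
    and lines_distinct: "\<And>i j. i \<in> {1..d} \<Longrightarrow> j \<in> {1..d} \<Longrightarrow> i \<noteq> j \<Longrightarrow> cross (a i) (a j) \<noteq> (\<lambda>_. 0)"
    and lines_general: "\<And>i j k. i \<in> {1..d} \<Longrightarrow> j \<in> {1..d} \<Longrightarrow> k \<in> {1..d} \<Longrightarrow> i \<noteq> j \<Longrightarrow> j \<noteq> k \<Longrightarrow> i \<noteq> k \<Longrightarrow>
      dot (a k) (cross (a i) (a j)) \<noteq> 0"
    and points_off_lines: "\<And>i j. i \<in> {1..d} \<Longrightarrow> j \<in> {1..d} \<Longrightarrow> i \<noteq> j \<Longrightarrow> dot (a j) (cross (a i) (b i)) \<noteq> 0"
begin

definition line_form :: "nat \<Rightarrow> 'k coord_ring" where "line_form i = linear_form (a i)"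
definition point_form :: "nat \<Rightarrow> 'k coord_ring" where "point_form i = linear_form (b i)"
definition lines_prod :: "'k coord_ring" where "lines_prod = (\<Prod>j\<in>{1..d}. line_form j)"
definition mixed_prod :: "nat \<Rightarrow> 'k coord_ring" where "mixed_prod i = point_form i * (\<Prod>j\<in>{1..d} - {i}. line_form j)"

lemma exists_other_index: "\<exists>j\<in>{1..d}. j \<noteq> i"
proof (cases "i = 1")
  case True
  then show ?thesis using d by (intro bexI[of _ 2]) auto
next
  case False
  then show ?thesis using d by (intro bexI[of _ 1]) auto
qed

lemma a_nonzero: assumes "i \<in> {1..d}" shows "a i \<noteq> (\<lambda>_. 0)"
proof
  assume zero: "a i = (\<lambda>_. 0)"
  obtain j where j: "j \<in> {1..d}" "j \<noteq> i" using exists_other_index by blast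
  have "cross (a i) (a j) = (\<lambda>_. 0)" unfolding zero by (rule ext) (simp add: cross_def)
  then show False using lines_distinct[of i j] j assms by auto
qed

lemma line_form_nonzero: "i \<in> {1..d} \<Longrightarrow> line_form i \<noteq> 0"
  unfolding line_form_def by (intro linear_form_nonzero a_nonzero)

lemma lines_prod_nonzero: "lines_prod \<noteq> 0"
  using line_form_nonzero by (simp add: lines_prod_def)

lemma line_form_dvd_mult: "i \<in> {1..d} \<Longrightarrow> line_form i dvd x * y \<Longrightarrow> line_form i dvd x \<or> line_form i dvd y"
  unfolding line_form_def by (intro linear_form_dvd_mult a_nonzero)

lemma line_form_not_dvd_line_form: 
  assumes "i \<in> {1..d}" "j \<in> {1..d}" "i \<noteq> j" shows "\<not> line_form i dvd line_form j"
  unfolding line_form_def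
  using points_off_lines[OF assms] by (intro linear_form_not_dvd[of _ "cross (a i) (b i)"] dot_cross_left) simp

text \<open>
  With \<open>b i\<close> in the place of \<open>a i\<close>, the \<open>d\<close> lines cut \<open>L\<^sub>i\<close> in \<open>d\<close> distinct points: the \<open>d - 1\<close> star points
  on it and \<open>q\<^sub>i\<close>.
\<close>

lemma extended_general:
  assumes "i \<in> {1..d}" "j \<in> {1..d}" "k \<in> {1..d}" "j \<noteq> k"
  shows "dot (if j = i then b i else a j) (cross (a i) (if k = i then b i else a k)) \<noteq> 0"
proof -
  have "dot (b i) (cross (a i) (a k)) \<noteq> 0" if "k \<noteq> i"
    using points_off_lines[of i k] assms that
    by (metis dot_cross_rotate dot_cross_swap neg_equal_0_iff_equal)
  then show ?thesis
    using points_off_lines[of i j] lines_general[of i k j] assms by auto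
qed

lemma points_nonzero: "i \<in> {1..d} \<Longrightarrow> cross (a i) (b i) \<noteq> (\<lambda>_. 0)"
  using exists_other_index[of i] points_off_lines[of i] by (metis dot_zero)

lemma line_form_dvd_mixed_prod: 
  assumes "i \<in> {1..d}" "i \<noteq> j" shows "line_form i dvd mixed_prod j"
  unfolding mixed_prod_def using assms by (intro dvd_mult dvd_prodI) auto

lemma line_form_mult_mixed_prod: 
  assumes "i \<in> {1..d}" shows "line_form i * mixed_prod i = point_form i * lines_prod"
  using prod.remove[of "{1..d}" i line_form] assms by (simp add: mixed_prod_def lines_prod_def mult.left_commute)

lemma line_form_not_dvd_mixed_prod:
  assumes i: "i \<in> {1..d}" shows "\<not> line_form i dvd mixed_prod i"
proof -
  obtain j where j: "j \<in> {1..d}" "j \<noteq> i" using exists_other_index by blast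
  have "\<not> line_form i dvd point_form i"
    unfolding line_form_def point_form_def
    using extended_general[of i i j] i j
    by (intro linear_form_not_dvd[of _ "cross (a i) (a j)"] dot_cross_left) simp
  moreover have "\<not> line_form i dvd (\<Prod>k\<in>B. line_form k)" if "finite B" "B \<subseteq> {1..d} - {i}" for B
    using that
  proof (induction B rule: finite_induct)
    case empty
    then show ?case
      using linear_form_not_dvd[of "a i" "\<lambda>_. 0" 1] by (simp add: line_form_def dot_zero)
  next
    case (insert k B)
    then show ?case
      using line_form_dvd_mult[OF i, of "line_form k" "\<Prod>k\<in>B. line_form k"] line_form_not_dvd_line_form[OF i, of k] by auto
  qed
  ultimately show ?thesis
    unfolding mixed_prod_def using line_form_dvd_mult[OF i] by (metis finite_Diff finite_atLeastAtMost subset_refl)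
qed

text \<open>
  On \<open>L\<^sub>i\<close> the form \<open>f\<close> vanishes at the \<open>d\<close> zeros of \<open>mixed_prod i\<close>, so it is a multiple of
  \<open>mixed_prod i\<close> there; this determines a coefficient \<open>u i\<close> modulo \<open>line_form i\<close>. Since \<open>mixed_prod j\<close> vanishes on \<open>L\<^sub>i\<close> for \<open>j \<noteq> i\<close>, the coefficients found on
  the different lines do not interfere, and what is left vanishes on all the lines.
\<close>

lemma vanishing_form_decomposition:
  assumes f: "homogeneous n f"
    and points: "\<And>i. i \<in> {1..d} \<Longrightarrow> poly_eval f (cross (a i) (b i)) = 0"
    and star: "\<And>i j. i \<in> {1..d} \<Longrightarrow> j \<in> {1..d} \<Longrightarrow> i \<noteq> j \<Longrightarrow> poly_eval f (cross (a i) (a j)) = 0"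
  obtains u0 u where "f = u0 * lines_prod + (\<Sum>i\<in>{1..d}. u i * mixed_prod i)"
proof -
  have "\<exists>u w. f = u * mixed_prod i + w * line_form i" if i: "i \<in> {1..d}" for i
  proof -
    let ?b = "\<lambda>j. if j = i then b i else a j"
    have "\<exists>u w. homogeneous (n - int (card {1..d})) u \<and>
        f = u * (\<Prod>j\<in>{1..d}. linear_form (?b j)) + w * linear_form (a i)"
    proof (rule vanishing_on_line_points[OF _ f])
      show "poly_eval f (cross (a i) (?b j)) = 0" if "j \<in> {1..d}" for j
        using points star i that by auto
      show "cross (a i) (?b j) \<noteq> (\<lambda>_. 0)" if "j \<in> {1..d}" for j
        using points_nonzero lines_distinct i that by auto
      show "dot (?b j) (cross (a i) (?b k)) \<noteq> 0" if "j \<in> {1..d}" "k \<in> {1..d}" "j \<noteq> k" for j k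
        using extended_general i that by auto
    qed simp
    moreover have "(\<Prod>j\<in>{1..d}. linear_form (?b j)) = mixed_prod i"
      using i prod.remove[of "{1..d}" i "\<lambda>j. linear_form (?b j)"] by (simp add: mixed_prod_def point_form_def line_form_def)
    ultimately show ?thesis by (auto simp: line_form_def)
  qed
  then obtain u w where uw: "\<And>i. i \<in> {1..d} \<Longrightarrow> f = u i * mixed_prod i + w i * line_form i" by metis
  let ?h = "f - (\<Sum>i\<in>{1..d}. u i * mixed_prod i)"
  have "line_form i dvd ?h" if i: "i \<in> {1..d}" for i
  proof -
    have "?h = w i * line_form i - (\<Sum>j\<in>{1..d} - {i}. u j * mixed_prod j)"
      using i uw[OF i] sum.remove[of "{1..d}" i "\<lambda>j. u j * mixed_prod j"] by simp
    moreover have "line_form i dvd (\<Sum>j\<in>{1..d} - {i}. u j * mixed_prod j)"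
      using line_form_dvd_mixed_prod[OF i] by (intro dvd_sum dvd_mult) auto
    ultimately show ?thesis by simp
  qed
  then have "lines_prod dvd ?h"
    unfolding lines_prod_def line_form_def using a_nonzero line_form_not_dvd_line_form
    by (intro prod_linear_forms_dvd) (auto simp: line_form_def)
  then obtain u0 where "?h = lines_prod * u0" by (elim dvdE)
  then have "f = u0 * lines_prod + (\<Sum>i\<in>{1..d}. u i * mixed_prod i)" by (simp add: algebra_simps)
  then show thesis using that by blast
qed

text \<open>
  Modulo the prime \<open>line_form i\<close> only the term \<open>u i * mixed_prod i\<close> of a relation survives.
\<close>

lemma syzygies:
  assumes rel: "u0 * lines_prod + (\<Sum>i\<in>{1..d}. u i * mixed_prod i) = 0"
  shows "\<exists>w. (\<forall>i\<in>{1..d}. u i = line_form i * w i) \<and> u0 = - (\<Sum>i\<in>{1..d}. point_form i * w i)"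
proof -
  have "line_form i dvd u i" if i: "i \<in> {1..d}" for i
  proof -
    have "u i * mixed_prod i = - (u0 * lines_prod) - (\<Sum>j\<in>{1..d} - {i}. u j * mixed_prod j)"
      using rel i sum.remove[of "{1..d}" i "\<lambda>j. u j * mixed_prod j"] by (simp add: algebra_simps eq_neg_iff_add_eq_0)
    moreover have "line_form i dvd (\<Sum>j\<in>{1..d} - {i}. u j * mixed_prod j)"
      using line_form_dvd_mixed_prod[OF i] by (intro dvd_sum dvd_mult) auto
    moreover have "line_form i dvd u0 * lines_prod"
      unfolding lines_prod_def using i by (intro dvd_mult dvd_prodI) auto
    ultimately have "line_form i dvd u i * mixed_prod i" by simp
    then show ?thesis using line_form_dvd_mult[OF i] line_form_not_dvd_mixed_prod[OF i] by blast
  qed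
  then have "\<forall>i\<in>{1..d}. \<exists>w. u i = line_form i * w" by (auto simp: dvd_def)
  then obtain w where w: "\<And>i. i \<in> {1..d} \<Longrightarrow> u i = line_form i * w i"
    by metis
  have "(\<Sum>i\<in>{1..d}. u i * mixed_prod i) = (\<Sum>i\<in>{1..d}. point_form i * w i) * lines_prod"
    unfolding sum_distrib_right
  proof (rule sum.cong)
    fix i assume i: "i \<in> {1..d}"
    have "u i * mixed_prod i = (line_form i * mixed_prod i) * w i" using w[OF i] by (simp add: ac_simps)
    then show "u i * mixed_prod i = point_form i * w i * lines_prod" using line_form_mult_mixed_prod[OF i] by (simp add: ac_simps)
  qed simp
  then have "(u0 + (\<Sum>i\<in>{1..d}. point_form i * w i)) * lines_prod = 0"
    using rel by (simp add: distrib_right)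
  then have "u0 = - (\<Sum>i\<in>{1..d}. point_form i * w i)"
    using lines_prod_nonzero by (simp add: eq_neg_iff_add_eq_0)
  then show ?thesis using w by blast
qed

end

context quasi_star_forms
begin

definition gens :: "'k coord_ring mat" where
  "gens = mat 1 (d + 1) (\<lambda>(_, k). if k = 0 then lines_prod else mixed_prod k)"

text \<open>
  Column \<open>k\<close> is the relation between \<open>lines_prod\<close> and \<open>mixed_prod (Suc k)\<close>. The lines are numbered from
  \<open>1\<close> and the columns from \<open>0\<close>; the row index \<open>0\<close> belongs to \<open>lines_prod\<close>.
\<close>

definition syz :: "'k coord_ring mat" where
  "syz = mat (d + 1) d (\<lambda>(r, k). if r = 0 then - point_form (Suc k) else if r = Suc k then line_form (Suc k) else 0)"

lemma sum_shift: "(\<Sum>k<d. f (Suc k)) = (\<Sum>i\<in>{1..d}. f i)"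
  by (rule sum.reindex_bij_witness[of _ "\<lambda>i. i - 1" Suc]) auto

lemma gens_mult_vec:
  assumes v: "v \<in> carrier_vec (d + 1)"
  shows "(gens *\<^sub>v v) $ 0 = v $ 0 * lines_prod + (\<Sum>i\<in>{1..d}. v $ i * mixed_prod i)"
proof -
  have "(gens *\<^sub>v v) $ 0 = (\<Sum>k<Suc d. (if k = 0 then lines_prod else mixed_prod k) * v $ k)"
    using v by (simp add: gens_def scalar_prod_def lessThan_atLeast0)
  also have "\<dots> = lines_prod * v $ 0 + (\<Sum>k<d. mixed_prod (Suc k) * v $ Suc k)"
    by (subst sum.lessThan_Suc_shift) simp
  finally show ?thesis
    using sum_shift[of "\<lambda>i. mixed_prod i * v $ i"] by (simp add: mult.commute)
qed

lemma syz_mult_vec: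
  assumes w: "w \<in> carrier_vec d"
  shows "(syz *\<^sub>v w) $ 0 = - (\<Sum>i\<in>{1..d}. point_form i * w $ (i - 1))"
    and "i \<in> {1..d} \<Longrightarrow> (syz *\<^sub>v w) $ i = line_form i * w $ (i - 1)"
proof -
  have "(syz *\<^sub>v w) $ 0 = (\<Sum>k<d. - point_form (Suc k) * w $ k)"
    using w by (simp add: syz_def scalar_prod_def lessThan_atLeast0)
  also have "\<dots> = - (\<Sum>k<d. point_form (Suc k) * w $ (Suc k - 1))"
    by (simp add: sum_negf)
  finally show "(syz *\<^sub>v w) $ 0 = - (\<Sum>i\<in>{1..d}. point_form i * w $ (i - 1))"
    using sum_shift[of "\<lambda>i. point_form i * w $ (i - 1)"] by simp
  assume i: "i \<in> {1..d}"
  have "(syz *\<^sub>v w) $ i = (\<Sum>k<d. (if i = Suc k then line_form (Suc k) else 0) * w $ k)"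
    using w i by (simp add: syz_def scalar_prod_def lessThan_atLeast0)
  also have "\<dots> = (\<Sum>k<d. if k = i - 1 then line_form i * w $ (i - 1) else 0)"
    using i by (intro sum.cong) auto
  also have "\<dots> = line_form i * w $ (i - 1)"
  proof -
    have "i - 1 < d" using i by auto
    then show ?thesis by simp
  qed
  finally show "(syz *\<^sub>v w) $ i = line_form i * w $ (i - 1)" .
qed

lemma gens_carrier: "gens \<in> carrier_mat 1 (d + 1)"
  and syz_carrier: "syz \<in> carrier_mat (d + 1) d"
  by (simp_all add: gens_def syz_def)

lemma homogeneous_line_form: "homogeneous 1 (line_form i)" and homogeneous_point_form: "homogeneous 1 (point_form i)"
  by (simp_all add: line_form_def point_form_def homogeneous_linear_form)

lemma homogeneous_lines_prod: "homogeneous (int d) lines_prod"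
  using homogeneous_prod[of "{1..d}" line_form] homogeneous_line_form by (simp add: lines_prod_def)

lemma homogeneous_mixed_prod: 
  assumes "i \<in> {1..d}" shows "homogeneous (int d) (mixed_prod i)"
proof -
  have "homogeneous (1 + int (card ({1..d} - {i}))) (mixed_prod i)"
    unfolding mixed_prod_def by (intro homogeneous_mult homogeneous_point_form homogeneous_prod homogeneous_line_form) auto
  moreover have "1 + int (card ({1..d} - {i})) = int d"
    using assms d by simp
  ultimately show ?thesis by simp
qed

lemma kernel_gens: "mat_kernel gens = mat_image syz"
proof (intro equalityI subsetI)
  fix v assume "v \<in> mat_kernel gens"
  then have v: "v \<in> carrier_vec (d + 1)" "gens *\<^sub>v v = 0\<^sub>v 1"
    using mat_kernelD[OF gens_carrier] by auto
  then have "v $ 0 * lines_prod + (\<Sum>i\<in>{1..d}. v $ i * mixed_prod i) = 0"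
    using gens_mult_vec[OF v(1)] by simp
  from syzygies[OF this] obtain w
    where w: "\<And>i. i \<in> {1..d} \<Longrightarrow> v $ i = line_form i * w i" "v $ 0 = - (\<Sum>i\<in>{1..d}. point_form i * w i)"
    by blast
  let ?w = "vec d (\<lambda>k. w (Suc k))"
  have "v = syz *\<^sub>v ?w"
  proof (rule eq_vecI)
    fix i assume "i < dim_vec (syz *\<^sub>v ?w)"
    then have "i = 0 \<or> i \<in> {1..d}" using syz_carrier by auto
    then show "v $ i = (syz *\<^sub>v ?w) $ i"
    proof
      assume "i = 0"
      have "(\<Sum>i\<in>{1..d}. point_form i * ?w $ (i - 1)) = (\<Sum>i\<in>{1..d}. point_form i * w i)"
        by (intro sum.cong) auto
      then show ?thesis using \<open>i = 0\<close> w(2) syz_mult_vec(1)[of ?w] by simp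
    next
      assume i: "i \<in> {1..d}"
      then have "?w $ (i - 1) = w i" by auto
      then show ?thesis using w(1)[OF i] syz_mult_vec(2)[OF _ i, of ?w] by simp
    qed
  qed (use v syz_carrier in auto)
  then show "v \<in> mat_image syz" using syz_carrier unfolding mat_image_def by auto
next
  fix v assume "v \<in> mat_image syz"
  then obtain w where w: "w \<in> carrier_vec d" "v = syz *\<^sub>v w"
    using syz_carrier unfolding mat_image_def by auto
  have v: "v \<in> carrier_vec (d + 1)" using w syz_carrier by auto
  have "(\<Sum>i\<in>{1..d}. v $ i * mixed_prod i) = (\<Sum>i\<in>{1..d}. point_form i * w $ (i - 1)) * lines_prod"
    unfolding sum_distrib_right
  proof (rule sum.cong)
    fix i assume i: "i \<in> {1..d}"
    have "v $ i * mixed_prod i = (line_form i * mixed_prod i) * w $ (i - 1)"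
      using syz_mult_vec(2)[OF w(1) i] w(2) by (simp add: ac_simps)
    then show "v $ i * mixed_prod i = point_form i * w $ (i - 1) * lines_prod"
      using line_form_mult_mixed_prod[OF i] by (simp add: ac_simps)
  qed simp
  then have "(gens *\<^sub>v v) $ 0 = 0"
    using gens_mult_vec[OF v] syz_mult_vec(1)[OF w(1)] w(2) by simp
  then have "gens *\<^sub>v v = 0\<^sub>v 1"
    using gens_carrier by (intro eq_vecI) auto
  then show "v \<in> mat_kernel gens" using v by (intro mat_kernelI[OF gens_carrier])
qed

lemma kernel_syz: "mat_kernel syz = {0\<^sub>v d}"
proof (intro equalityI subsetI)
  fix w assume "w \<in> mat_kernel syz"
  then have w: "w \<in> carrier_vec d" "syz *\<^sub>v w = 0\<^sub>v (d + 1)"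
    using mat_kernelD[OF syz_carrier] by auto
  have "w = 0\<^sub>v d"
  proof (rule eq_vecI)
    fix k assume "k < dim_vec (0\<^sub>v d :: 'k coord_ring vec)"
    then have k: "k < d" by simp
    then have "line_form (Suc k) * w $ k = 0"
      using syz_mult_vec(2)[OF w(1), of "Suc k"] w(2) by simp
    then show "w $ k = 0\<^sub>v d $ k" using line_form_nonzero[of "Suc k"] k by simp
  qed (use w in auto)
  then show "w \<in> {0\<^sub>v d}" by simp
next
  fix w assume "w \<in> {0\<^sub>v d :: 'k coord_ring vec}"
  then have "w = 0\<^sub>v d" by simp
  then show "w \<in> mat_kernel syz"
    using syz_carrier by (intro mat_kernelI[OF syz_carrier]) (auto intro!: eq_vecI)
qed

text \<open>
  The set \<open>Z\<close> enters through representatives of its points only: \<open>points\<close> and \<open>star\<close> provide the zeros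
  needed to decompose a form of the ideal, and \<open>cover\<close> gives the vanishing of the generators.
\<close>

lemma linear_resolution_ideal_of_points:
  assumes points: "\<And>i. i \<in> {1..d} \<Longrightarrow> \<exists>p\<in>Z. cross (a i) (b i) \<in> p"
    and star: "\<And>i j. i \<in> {1..d} \<Longrightarrow> j \<in> {1..d} \<Longrightarrow> i \<noteq> j \<Longrightarrow> \<exists>p\<in>Z. cross (a i) (a j) \<in> p"
    and cover: "\<And>p v. p \<in> Z \<Longrightarrow> v \<in> p \<Longrightarrow>
      (\<exists>i\<in>{1..d}. dot (a i) v = 0 \<and> dot (b i) v = 0) \<or>
      (\<exists>i\<in>{1..d}. \<exists>j\<in>{1..d}. i \<noteq> j \<and> dot (a i) v = 0 \<and> dot (a j) v = 0)"
  shows "linear_resolution (ideal_of_points Z) (int d) (d + 1) d gens syz"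
proof
  show "homogeneous (int d) (gens $$ (0, k))" if "k < d + 1" for k
    using that homogeneous_lines_prod homogeneous_mixed_prod[of k] by (simp add: gens_def)
  show "homogeneous 1 (syz $$ (i, k))" if "i < d + 1" "k < d" for i k
    using that by (simp add: syz_def homogeneous_line_form homogeneous_point_form homogeneous_uminus homogeneous_zero)
  show "elements_mat syz \<subseteq> irrelevant_ideal"
  proof
    fix x assume "x \<in> elements_mat syz"
    then obtain r k where "r < dim_row syz" "k < dim_col syz" "x = syz $$ (r, k)"
      unfolding elements_mat_def by force
    then have "x = (if r = 0 then - point_form (Suc k) else if r = Suc k then line_form (Suc k) else 0)"
      by (simp add: syz_def)
    moreover have "- linear_form (b (Suc k)) \<in> irrelevant_ideal" "(0 :: 'k coord_ring) \<in> irrelevant_ideal"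
      using linear_form_in_irrelevant_ideal[of "b (Suc k)"] unfolding irrelevant_ideal_def ideal_generated_def
      by (auto intro: Modules.module.span_neg[OF module_times] Modules.module.span_zero[OF module_times])
    ultimately show "x \<in> irrelevant_ideal"
      using linear_form_in_irrelevant_ideal by (auto simp: line_form_def point_form_def)
  qed
  let ?S = "{f. (\<exists>n. homogeneous n f) \<and> (\<forall>p\<in>Z. \<forall>v\<in>p. poly_eval f v = 0)}"
  have lines_prod_in: "lines_prod \<in> ?S"
  proof -
    have "poly_eval lines_prod v = 0" if pv: "p \<in> Z" "v \<in> p" for p v
    proof -
      obtain i where "i \<in> {1..d}" "dot (a i) v = 0" using cover[OF pv] by blast
      then show ?thesis by (auto simp: lines_prod_def line_form_def poly_eval.hom_prod)
    qed
    then show ?thesis using homogeneous_lines_prod by auto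
  qed
  have mixed_prod_in: "mixed_prod k \<in> ?S" if k: "k \<in> {1..d}" for k
  proof -
    have "poly_eval (mixed_prod k) v = 0" if pv: "p \<in> Z" "v \<in> p" for p v
    proof -
      have "dot (b k) v = 0 \<or> (\<exists>i\<in>{1..d} - {k}. dot (a i) v = 0)"
        using cover[OF pv] by blast
      then show ?thesis
        by (auto simp: mixed_prod_def line_form_def point_form_def poly_eval.hom_prod poly_eval.hom_mult)
    qed
    then show ?thesis using homogeneous_mixed_prod[OF k] by auto
  qed
  show "(\<lambda>v. v $ 0) ` mat_image gens = ideal_of_points Z"
  proof (intro equalityI subsetI)
    fix f assume "f \<in> (\<lambda>v. v $ 0) ` mat_image gens"
    then obtain v where v: "v \<in> carrier_vec (d + 1)" "f = (gens *\<^sub>v v) $ 0"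
      using gens_carrier unfolding mat_image_def by auto
    have "f = v $ 0 * lines_prod + (\<Sum>i\<in>{1..d}. v $ i * mixed_prod i)"
      using gens_mult_vec[OF v(1)] v(2) by simp
    then show "f \<in> ideal_of_points Z"
      unfolding ideal_of_points_def ideal_generated_def
      using lines_prod_in mixed_prod_in
      by (simp only:) (intro Modules.module.span_add[OF module_times] Modules.module.span_sum[OF module_times]
          Modules.module.span_scale[OF module_times] Modules.module.span_base[OF module_times])
  next
    define J where "J = {u0 * lines_prod + (\<Sum>i\<in>{1..d}. u i * mixed_prod i) | u0 u. True}"
    have J_I: "x \<in> J" if "x = u0 * lines_prod + (\<Sum>i\<in>{1..d}. u i * mixed_prod i)" for x u0 u
      using that unfolding J_def by blast
    have "is_ideal J"
      unfolding is_ideal_def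
    proof (intro conjI ballI allI)
      show "0 \<in> J" by (rule J_I[of _ 0 "\<lambda>_. 0"]) simp
    next
      fix x y assume "x \<in> J" "y \<in> J"
      then obtain u0 u u0' u' where "x = u0 * lines_prod + (\<Sum>i\<in>{1..d}. u i * mixed_prod i)"
        "y = u0' * lines_prod + (\<Sum>i\<in>{1..d}. u' i * mixed_prod i)"
        unfolding J_def by blast
      then have "x + y = (u0 + u0') * lines_prod + (\<Sum>i\<in>{1..d}. (u i + u' i) * mixed_prod i)"
        by (simp add: algebra_simps sum.distrib)
      then show "x + y \<in> J" by (rule J_I)
    next
      fix c x assume "x \<in> J"
      then obtain u0 u where "x = u0 * lines_prod + (\<Sum>i\<in>{1..d}. u i * mixed_prod i)"
        unfolding J_def by blast
      then have "c * x = (c * u0) * lines_prod + (\<Sum>i\<in>{1..d}. (c * u i) * mixed_prod i)"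
        by (simp add: algebra_simps sum_distrib_left)
      then show "c * x \<in> J" by (rule J_I)
    qed
    moreover have "?S \<subseteq> J"
    proof
      fix f assume "f \<in> ?S"
      then obtain n where f: "homogeneous n f" "\<And>p v. p \<in> Z \<Longrightarrow> v \<in> p \<Longrightarrow> poly_eval f v = 0" by auto
      obtain u0 u where "f = u0 * lines_prod + (\<Sum>i\<in>{1..d}. u i * mixed_prod i)"
      proof (rule vanishing_form_decomposition[OF f(1)])
        show "poly_eval f (cross (a i) (b i)) = 0" if i: "i \<in> {1..d}" for i
          using points[OF i] f(2) by auto
        show "poly_eval f (cross (a i) (a j)) = 0" if ij: "i \<in> {1..d}" "j \<in> {1..d}" "i \<noteq> j" for i j
          using star[OF ij] f(2) by auto
      qed
      then show "f \<in> J" by (rule J_I)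
    qed
    ultimately have sub: "ideal_of_points Z \<subseteq> J"
      unfolding ideal_of_points_def ideal_generated_def
      by (intro Modules.module.span_minimal[OF module_times])
    fix f assume "f \<in> ideal_of_points Z"
    then obtain u0 u where f: "f = u0 * lines_prod + (\<Sum>i\<in>{1..d}. u i * mixed_prod i)"
      using sub unfolding J_def by blast
    let ?v = "vec (d + 1) (\<lambda>k. if k = 0 then u0 else u k)"
    have "(\<Sum>i\<in>{1..d}. ?v $ i * mixed_prod i) = (\<Sum>i\<in>{1..d}. u i * mixed_prod i)"
      by (intro sum.cong) auto
    then have "f = (gens *\<^sub>v ?v) $ 0"
      using gens_mult_vec[of ?v] by (simp add: f)
    moreover have "gens *\<^sub>v ?v \<in> mat_image gens"
      using gens_carrier unfolding mat_image_def by auto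
    ultimately show "f \<in> (\<lambda>v. v $ 0) ` mat_image gens" by blast
  qed
qed (rule gens_carrier syz_carrier kernel_gens kernel_syz)+

end

section \<open>Coordinates for a quasi star configuration\<close>

lemma cross_cross: "cross a (cross b c) j = b j * dot a c - c j * dot a b"
proof -
  have s: "j + 1 + 1 = j + 2" "j + 1 + 2 = j" "j + 2 + 1 = j" "j + 2 + 2 = j + 1" by (rule shift_3)+
  show ?thesis
    unfolding dot_def sum_3_shift[of _ j] cross_def s by (simp add: algebra_simps)
qed

lemma dot_eq_zero_if_cross_eq_zero:
  assumes "cross a b = (\<lambda>_. 0)" "a \<noteq> (\<lambda>_. 0)" "dot a v = 0" shows "dot b v = 0"
proof -
  obtain k where k: "a k \<noteq> 0" using assms(2) by auto
  have comm: "dot v c = dot c v" for c by (simp add: dot_def mult.commute)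
  have "cross v (\<lambda>_. 0) k = 0" by (simp add: cross_def)
  then have "a k * dot b v = 0"
    using cross_cross[of v a b k] assms by (simp add: comm)
  then show ?thesis using k by simp
qed

text \<open>
  If the coordinate \<open>a\<^sub>k\<close> is nonzero, the line \<open>e\<^sub>k \<times> v\<close> joining \<open>v\<close> to the \<open>k\<close>-th coordinate point works,
  because \<open>a \<times> (e\<^sub>k \<times> v) = (a \<bullet> v) e\<^sub>k - a\<^sub>k v\<close>.
\<close>

lemma exists_second_line:
  assumes "a \<noteq> (\<lambda>_. 0)" "dot a v = 0"
  shows "\<exists>b c. c \<noteq> 0 \<and> cross a b = (\<lambda>j. c * v j)"
proof -
  obtain k where k: "a k \<noteq> 0" using assms(1) by auto
  let ?e = "\<lambda>i. if i = k then 1 else 0"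
  have "dot a ?e = a k" by (simp add: dot_def if_distrib[of "\<lambda>x. _ * x"] cong: if_cong)
  then have "cross a (cross ?e v) = (\<lambda>j. - a k * v j)"
    using assms(2) by (intro ext) (simp add: cross_cross)
  then show ?thesis using k by (intro exI[of _ "cross ?e v"] exI[of _ "- a k"]) simp
qed

lemma proj_plane_members:
  assumes "p \<in> proj_plane" "v \<in> p"
  shows "v \<noteq> (\<lambda>_. 0)" and "w \<in> p \<longleftrightarrow> (\<exists>c. c \<noteq> 0 \<and> w = (\<lambda>i. c * v i))"
proof -
  obtain u where u: "u \<noteq> (\<lambda>_. 0)" "p = proj_rel `` {u}"
    using assms(1) by (auto simp: proj_plane_def quotient_def)
  obtain c where c: "c \<noteq> 0" "v = (\<lambda>i. c * u i)"
    using assms(2) u by (auto simp: proj_rel_def)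
  show v: "v \<noteq> (\<lambda>_. 0)" using assms(2) u by (auto simp: proj_rel_def)
  have scale: "(\<lambda>i. s * x i) \<noteq> (\<lambda>_. 0)" if "s \<noteq> 0" "x \<noteq> (\<lambda>_. 0)" for s and x :: "3 \<Rightarrow> 'a"
    using that by (auto simp: fun_eq_iff)
  show "w \<in> p \<longleftrightarrow> (\<exists>c. c \<noteq> 0 \<and> w = (\<lambda>i. c * v i))"
  proof
    assume "w \<in> p"
    then obtain c' where "c' \<noteq> 0" "w = (\<lambda>i. c' * u i)" using u by (auto simp: proj_rel_def)
    then show "\<exists>c. c \<noteq> 0 \<and> w = (\<lambda>i. c * v i)"
      using c by (intro exI[of _ "c' / c"]) auto
  next
    assume "\<exists>c. c \<noteq> 0 \<and> w = (\<lambda>i. c * v i)"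
    then obtain c' where c': "c' \<noteq> 0" "w = (\<lambda>i. c' * v i)" by auto
    then have "w = (\<lambda>i. (c' * c) * u i)" using c by (simp add: mult.assoc)
    moreover have "w \<noteq> (\<lambda>_. 0)" using scale[OF c'(1) v] c'(2) by simp
    ultimately show "w \<in> p"
      using u c c' by (auto simp: proj_rel_def intro!: exI[of _ "c' * c"])
  qed
qed

lemma proj_class:
  assumes "v \<noteq> (\<lambda>_. 0)" obtains p where "p \<in> proj_plane" "v \<in> p"
proof -
  have "proj_rel `` {v} \<in> proj_plane" using assms by (auto simp: proj_plane_def quotient_def)
  moreover have "v \<in> proj_rel `` {v}" using assms by (auto simp: proj_rel_def intro!: exI[of _ 1])
  ultimately show thesis using that by blast
qed

lemma proj_plane_nonempty:
  assumes "p \<in> proj_plane" shows "\<exists>v. v \<in> p"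
proof -
  obtain u where u: "u \<noteq> (\<lambda>_. 0)" "p = proj_rel `` {u}"
    using assms by (auto simp: proj_plane_def quotient_def)
  then have "u \<in> p" by (auto simp: proj_rel_def intro!: exI[of _ 1])
  then show ?thesis by blast
qed

lemma dot_proj_class:
  assumes "p \<in> proj_plane" "v \<in> p" "w \<in> p" shows "dot a w = 0 \<longleftrightarrow> dot a v = 0"
  using proj_plane_members(2)[OF assms(1,2), of w] assms(3) by (auto simp: dot_scale)

text \<open>
  Every condition on the lines and points becomes the vanishing or non-vanishing of a form at an
  intersection point. In particular, distinct lines have a nonzero cross product, since otherwise
  each would contain the other by \<open>dot_eq_zero_if_cross_eq_zero\<close>.
\<close>

lemma quasi_star_configuration_forms:
  assumes "quasi_star_configuration d Z"
  obtains a b where "quasi_star_forms d a b"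
    "\<And>i. i \<in> {1..d} \<Longrightarrow> \<exists>p\<in>Z. cross (a i) (b i) \<in> p"
    "\<And>i j. i \<in> {1..d} \<Longrightarrow> j \<in> {1..d} \<Longrightarrow> i \<noteq> j \<Longrightarrow> \<exists>p\<in>Z. cross (a i) (a j) \<in> p"
    "\<And>p v. p \<in> Z \<Longrightarrow> v \<in> p \<Longrightarrow>
      (\<exists>i\<in>{1..d}. dot (a i) v = 0 \<and> dot (b i) v = 0) \<or>
      (\<exists>i\<in>{1..d}. \<exists>j\<in>{1..d}. i \<noteq> j \<and> dot (a i) v = 0 \<and> dot (a j) v = 0)"
proof -
  obtain L q where d: "d \<ge> 3" and gen: "general_lines d L"
    and qL: "\<And>i. i \<in> {1..d} \<Longrightarrow> q i \<in> L i"
    and q_star: "q ` {1..d} \<inter> star_configuration d L = {}"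
    and Z: "Z = q ` {1..d} \<union> star_configuration d L"
    using assms unfolding quasi_star_configuration_def by blast
  have "\<forall>i\<in>{1..d}. \<exists>c. c \<noteq> (\<lambda>_. 0) \<and> L i = {p \<in> proj_plane. \<forall>v\<in>p. dot c v = 0}"
    using gen unfolding general_lines_def proj_line_def dot_def by blast
  from bchoice[OF this] obtain a where
    "\<forall>i\<in>{1..d}. a i \<noteq> (\<lambda>_. 0) \<and> L i = {p \<in> proj_plane. \<forall>v\<in>p. dot (a i) v = 0}"
    by blast
  then have a: "\<And>i. i \<in> {1..d} \<Longrightarrow> a i \<noteq> (\<lambda>_. 0)"
    and L: "\<And>i. i \<in> {1..d} \<Longrightarrow> L i = {p \<in> proj_plane. \<forall>v\<in>p. dot (a i) v = 0}"
    by blast+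
  have on_L: "p \<in> L i \<longleftrightarrow> dot (a i) v = 0" if "i \<in> {1..d}" "p \<in> proj_plane" "v \<in> p" for i p v
    unfolding L[OF that(1)] using dot_proj_class[OF that(2,3)] that(2,3) by blast
  have star: "L i \<inter> L j \<subseteq> star_configuration d L" if "i \<in> {1..d}" "j \<in> {1..d}" "i \<noteq> j" for i j
    using that unfolding star_configuration_def by blast
  have cross_a: "cross (a i) (a j) \<noteq> (\<lambda>_. 0)" if ij: "i \<in> {1..d}" "j \<in> {1..d}" "i \<noteq> j" for i j
  proof
    assume zero: "cross (a i) (a j) = (\<lambda>_. 0)"
    then have zero': "cross (a j) (a i) = (\<lambda>_. 0)"
      by (intro ext) (simp add: cross_anticomm[of "a j" "a i"])
    have "dot (a i) v = 0 \<longleftrightarrow> dot (a j) v = 0" for v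
      using dot_eq_zero_if_cross_eq_zero[OF zero a[OF ij(1)]]
        dot_eq_zero_if_cross_eq_zero[OF zero' a[OF ij(2)]] by blast
    then have "L i = L j" unfolding L[OF ij(1)] L[OF ij(2)] by simp
    then show False using gen ij unfolding general_lines_def by (auto dest: inj_onD)
  qed
  have star_point: "\<exists>p \<in> L i \<inter> L j. p \<in> proj_plane \<and> cross (a i) (a j) \<in> p"
    if ij: "i \<in> {1..d}" "j \<in> {1..d}" "i \<noteq> j" for i j
  proof -
    obtain p where p: "p \<in> proj_plane" "cross (a i) (a j) \<in> p"
      using proj_class[OF cross_a[OF ij]] .
    then show ?thesis using on_L[OF ij(1) p] on_L[OF ij(2) p] dot_cross_left dot_cross_right by blast
  qed
  have q_plane: "q i \<in> proj_plane" if "i \<in> {1..d}" for i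
    using qL[OF that] unfolding L[OF that] by blast
  have "\<exists>b. cross (a i) b \<in> q i" if i: "i \<in> {1..d}" for i
  proof -
    obtain v where v: "v \<in> q i"
      using proj_plane_nonempty[OF q_plane[OF i]] by blast
    have "dot (a i) v = 0" using on_L[OF i q_plane[OF i] v] qL[OF i] by simp
    then obtain b c where "c \<noteq> 0" "cross (a i) b = (\<lambda>j. c * v j)"
      using exists_second_line[OF a[OF i]] by blast
    then show ?thesis using proj_plane_members(2)[OF q_plane[OF i] v] by blast
  qed
  then have "\<forall>i\<in>{1..d}. \<exists>b. cross (a i) b \<in> q i" by blast
  then obtain b where b: "\<And>i. i \<in> {1..d} \<Longrightarrow> cross (a i) (b i) \<in> q i"
    using bchoice[of "{1..d}" "\<lambda>i b. cross (a i) b \<in> q i"] by blast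
  show thesis
  proof (rule that)
    show "quasi_star_forms d a b"
    proof
      show "2 \<le> d" using d by simp
      show "cross (a i) (a j) \<noteq> (\<lambda>_. 0)" if "i \<in> {1..d}" "j \<in> {1..d}" "i \<noteq> j" for i j
        using cross_a[OF that] .
      show "dot (a k) (cross (a i) (a j)) \<noteq> 0"
        if ijk: "i \<in> {1..d}" "j \<in> {1..d}" "k \<in> {1..d}" "i \<noteq> j" "j \<noteq> k" "i \<noteq> k" for i j k
      proof
        assume zero: "dot (a k) (cross (a i) (a j)) = 0"
        obtain p where p: "p \<in> L i \<inter> L j" "p \<in> proj_plane" "cross (a i) (a j) \<in> p"
          using star_point[OF ijk(1,2,4)] by blast
        then have "p \<in> L i \<inter> L j \<inter> L k" using on_L[OF ijk(3) p(2,3)] zero by simp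
        moreover have "L i \<inter> L j \<inter> L k = {}" using gen ijk unfolding general_lines_def by blast
        ultimately show False by blast
      qed
      show "dot (a j) (cross (a i) (b i)) \<noteq> 0" if ij: "i \<in> {1..d}" "j \<in> {1..d}" "i \<noteq> j" for i j
      proof
        assume "dot (a j) (cross (a i) (b i)) = 0"
        then have "q i \<in> L j" using on_L[OF ij(2) q_plane[OF ij(1)] b[OF ij(1)]] by simp
        then have "q i \<in> star_configuration d L" using qL[OF ij(1)] star[OF ij] by blast
        then show False using q_star ij(1) by blast
      qed
    qed
    show "\<exists>p\<in>Z. cross (a i) (b i) \<in> p" if "i \<in> {1..d}" for i
      using b[OF that] that Z by blast
    show "\<exists>p\<in>Z. cross (a i) (a j) \<in> p" if "i \<in> {1..d}" "j \<in> {1..d}" "i \<noteq> j" for i j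
      using star_point[OF that] star[OF that] Z by blast
    fix p v assume p: "p \<in> Z" and v: "v \<in> p"
    show "(\<exists>i\<in>{1..d}. dot (a i) v = 0 \<and> dot (b i) v = 0) \<or>
      (\<exists>i\<in>{1..d}. \<exists>j\<in>{1..d}. i \<noteq> j \<and> dot (a i) v = 0 \<and> dot (a j) v = 0)"
    proof (cases "p \<in> star_configuration d L")
      case True
      then obtain i j where ij: "i \<in> {1..d}" "j \<in> {1..d}" "i \<noteq> j" "p \<in> L i" "p \<in> L j"
        unfolding star_configuration_def by blast
      then have "p \<in> proj_plane" using L[OF ij(1)] by blast
      then show ?thesis using ij on_L[of i p v] on_L[of j p v] v by blast
    next
      case False
      then obtain i where i: "i \<in> {1..d}" "p = q i" using p Z by blast
      have "dot (a i) v = 0" using on_L[OF i(1) q_plane[OF i(1)]] qL[OF i(1)] v i(2) by simp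
      moreover have "dot (b i) v = 0"
        using dot_proj_class[OF q_plane[OF i(1)] b[OF i(1)], of v] v i(2) dot_cross_right by blast
      ultimately show ?thesis using i(1) by blast
    qed
  qed
qed

theorem theorem3p3:
  fixes Z :: "(3 \<Rightarrow> 'k::alg_closed_field) set set"
    and I :: "'k coord_ring set"
    and d :: nat
  assumes "quasi_star_configuration d Z"
    and "I = ideal_of_points Z"
  shows "(\<exists>D M. minimal_free_resolution I D M) \<and>
         (\<forall>D M. minimal_free_resolution I D M \<longrightarrow>
            D 0 = replicate (d + 1) (int d) \<and>
            D 1 = replicate d (int d + 1) \<and>
            (\<forall>j\<ge>2. D j = [])) \<and>
         initial_degree I = d \<and>
         regularity I = int d"
proof -
  obtain a b where forms: "quasi_star_forms d a b"
    and points: "\<And>i. i \<in> {1..d} \<Longrightarrow> \<exists>p\<in>Z. cross (a i) (b i) \<in> p"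
    and star: "\<And>i j. i \<in> {1..d} \<Longrightarrow> j \<in> {1..d} \<Longrightarrow> i \<noteq> j \<Longrightarrow> \<exists>p\<in>Z. cross (a i) (a j) \<in> p"
    and cover: "\<And>p v. p \<in> Z \<Longrightarrow> v \<in> p \<Longrightarrow>
      (\<exists>i\<in>{1..d}. dot (a i) v = 0 \<and> dot (b i) v = 0) \<or>
      (\<exists>i\<in>{1..d}. \<exists>j\<in>{1..d}. i \<noteq> j \<and> dot (a i) v = 0 \<and> dot (a j) v = 0)"
    using quasi_star_configuration_forms[OF assms(1)] by blast
  interpret quasi_star_forms d a b by (rule forms)
  interpret linear_resolution I "int d" "d + 1" d gens syz
    unfolding assms(2) by (rule linear_resolution_ideal_of_points[OF points star cover])
  have "gens $$ (0, 0) \<noteq> 0" using lines_prod_nonzero by (simp add: gens_def)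
  then have "initial_degree I = d" by (intro initial_degree_eq[of 0]) auto
  then show ?thesis
    using exists_minimal_free_resolution minimal_free_resolution_degrees regularity_eq by simp
qed

end
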